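(* Let $n\geq 12$ and $1\leq \ell\leq \lfloor\frac{n+1}{2}\rfloor$ be integers. Then $$ f(n;\overline{\kappa}_{n-1}\leq \ell)=\begin{cases} \binom{n-2}{2}+2\ell, & \text{if } 1\leq \ell\leq \lfloor\frac{n-5}{2}\rfloor, \text{ or } \ell=\lfloor\frac{n-3}{2}\rfloor \text{ and } n \text{ is even};\\ \binom{n-2}{2}+2\ell+1, & \text{if } \ell=\lfloor\frac{n-3}{2}\rfloor \text{ and } n \text{ is odd};\\ \binom{n-1}{2}+\ell, & \text{if } \ell=\lfloor\frac{n-1}{2}\rfloor \text{ and } n \text{ is even};\\ \binom{n-1}{2}+2\ell-1, & \text{if } \ell=\lfloor\frac{n-1}{2}\rfloor \text{ and } n \text{ is odd};\\ \binom{n}{2}, & \text{if } \ell=\lfloor\frac{n+1}{2}\rfloor. \end{cases} $$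
   Context: All graphs are finite, simple and undirected; $e(G)$ is the number of edges of $G$. For a graph $G$ and $S\subseteq V(G)$ with $|S|\geq 2$, a tree connecting $S$ is a subgraph of $G$ that is a tree whose vertex set contains $S$. Two trees $T,T'$ connecting $S$ are internally disjoint if $E(T)\cap E(T')=\varnothing$ and $V(T)\cap V(T')=S$. Let $\kappa(S)$ be the maximum number of pairwise internally disjoint trees connecting $S$ in $G$. For $2\leq k\leq |V(G)|$, $\overline{\kappa}_k(G)=\max\{\kappa(S): S\subseteq V(G),\ |S|=k\}$. Define $f(n;\overline{\kappa}_k\leq \ell)=\max\{e(G): |V(G)|=n,\ \overline{\kappa}_k(G)\leq \ell\}$. *)

theory Defs
  imports Main
begin

type_synonym 'a graph = "'a set \<times> 'a set set"

abbreviation verts :: "'a graph \<Rightarrow> 'a set" where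
  "verts G \<equiv> fst G"

abbreviation edges :: "'a graph \<Rightarrow> 'a set set" where
  "edges G \<equiv> snd G"

definition simple_graph :: "'a graph \<Rightarrow> bool" where
  "simple_graph G \<longleftrightarrow> finite (verts G) \<and> (\<forall>e\<in>edges G. e \<subseteq> verts G \<and> card e = 2)"

text \<open>\<open>simple_graph H\<close> ensures that all ends of edges of \<open>H\<close> are vertices of \<open>H\<close>.\<close>

definition subgraph :: "'a graph \<Rightarrow> 'a graph \<Rightarrow> bool" where
  "subgraph H G \<longleftrightarrow> simple_graph H \<and> verts H \<subseteq> verts G \<and> edges H \<subseteq> edges G"

definition connected_graph :: "'a graph \<Rightarrow> bool" where
  "connected_graph G \<longleftrightarrow> verts G \<noteq> {} \<and>
     (\<forall>u\<in>verts G. \<forall>v\<in>verts G. (u, v) \<in> {(x, y). {x, y} \<in> edges G}\<^sup>*)"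

definition is_cycle :: "'a graph \<Rightarrow> 'a list \<Rightarrow> bool" where
  "is_cycle G c \<longleftrightarrow> 3 \<le> length c \<and> distinct c \<and> set c \<subseteq> verts G \<and>
     (\<forall>i. Suc i < length c \<longrightarrow> {c ! i, c ! Suc i} \<in> edges G) \<and> {last c, hd c} \<in> edges G"

definition is_tree :: "'a graph \<Rightarrow> bool" where
  "is_tree T \<longleftrightarrow> simple_graph T \<and> connected_graph T \<and> (\<nexists>c. is_cycle T c)"

definition tree_connecting :: "'a graph \<Rightarrow> 'a set \<Rightarrow> 'a graph \<Rightarrow> bool" where
  "tree_connecting G S T \<longleftrightarrow> subgraph T G \<and> is_tree T \<and> S \<subseteq> verts T"

definition internally_disjoint :: "'a set \<Rightarrow> 'a graph \<Rightarrow> 'a graph \<Rightarrow> bool" where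
  "internally_disjoint S T T' \<longleftrightarrow> edges T \<inter> edges T' = {} \<and> verts T \<inter> verts T' = S"

text \<open>
  If \<open>S\<close> has at least two elements, every tree connecting \<open>S\<close> has an edge, so internally
  disjoint trees are distinct and families of them may be taken to be sets.
\<close>

definition disjoint_tree_family :: "'a graph \<Rightarrow> 'a set \<Rightarrow> 'a graph set \<Rightarrow> bool" where
  "disjoint_tree_family G S F \<longleftrightarrow>
     (\<forall>T\<in>F. tree_connecting G S T) \<and> pairwise (internally_disjoint S) F"

definition kappa :: "'a graph \<Rightarrow> 'a set \<Rightarrow> nat" where
  "kappa G S = Max {card F | F. disjoint_tree_family G S F}"

definition kappa_bar :: "nat \<Rightarrow> 'a graph \<Rightarrow> nat" where
  "kappa_bar k G = Max {kappa G S | S. S \<subseteq> verts G \<and> card S = k}"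

text \<open>
  Every finite graph is isomorphic to one whose vertices are natural numbers, so it
  suffices to range over the latter.
\<close>

definition max_edges :: "nat \<Rightarrow> nat \<Rightarrow> nat \<Rightarrow> nat" where
  "max_edges n k l = Max {card (edges G) | G :: nat graph.
     simple_graph G \<and> card (verts G) = n \<and> kappa_bar k G \<le> l}"

text \<open>The maxima above are taken over finite nonempty sets.\<close>

lemma simple_graph_edges_subset: "simple_graph G \<Longrightarrow> edges G \<subseteq> Pow (verts G)"
  unfolding simple_graph_def by blast

lemma kappa_set_finite:
  assumes "simple_graph G"
  shows "finite {card F | F. disjoint_tree_family G S F}"
proof -
  have "finite (Pow (verts G) \<times> Pow (edges G))"
    using assms simple_graph_edges_subset[OF assms]
    by (auto simp: simple_graph_def intro: finite_subset)
  moreover have "{F. disjoint_tree_family G S F} \<subseteq> Pow (Pow (verts G) \<times> Pow (edges G))"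
    unfolding disjoint_tree_family_def tree_connecting_def subgraph_def
    by (intro subsetI PowI CollectI) (simp add: mem_Times_iff)
  ultimately have "finite {F. disjoint_tree_family G S F}"
    by (meson finite_Pow_iff finite_subset)
  then show ?thesis by simp
qed

lemma kappa_set_nonempty: "{card F | F. disjoint_tree_family G S F} \<noteq> {}"
proof -
  have "disjoint_tree_family G S {}" by (simp add: disjoint_tree_family_def)
  then show ?thesis by blast
qed

lemma kappa_bar_set_finite:
  "simple_graph G \<Longrightarrow> finite {kappa G S | S. S \<subseteq> verts G \<and> card S = k}"
  by (simp add: simple_graph_def)

lemma kappa_bar_set_nonempty:
  "k \<le> card (verts G) \<Longrightarrow> {kappa G S | S. S \<subseteq> verts G \<and> card S = k} \<noteq> {}"
  by (auto elim: obtain_subset_with_card_n)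

lemma max_edges_set_finite:
  "finite {card (edges G) | G :: nat graph.
     simple_graph G \<and> card (verts G) = n \<and> kappa_bar k G \<le> l}"
proof (rule finite_subset)
  show "{card (edges G) | G :: nat graph.
     simple_graph G \<and> card (verts G) = n \<and> kappa_bar k G \<le> l} \<subseteq> {..2 ^ n}"
  proof (intro subsetI, elim CollectE exE conjE)
    fix m and G :: "nat graph"
    assume m: "m = card (edges G)" and G: "simple_graph G" and n: "card (verts G) = n"
    have "card (edges G) \<le> card (Pow (verts G))"
      using G simple_graph_edges_subset[OF G] by (intro card_mono) (auto simp: simple_graph_def)
    then show "m \<in> {..2 ^ n}"
      using G m n by (simp add: card_Pow simple_graph_def)
  qed
qed simp

lemma edgeless_tree_connecting:
  assumes "tree_connecting (V, {}) S T"
  shows "card S \<le> 1"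
proof -
  have fin: "finite (verts T)" and E: "edges T = {}" and S: "S \<subseteq> verts T"
    and conn: "\<And>u v. u \<in> verts T \<Longrightarrow> v \<in> verts T \<Longrightarrow>
      (u, v) \<in> {(x, y). {x, y} \<in> edges T}\<^sup>*"
    using assms unfolding tree_connecting_def subgraph_def is_tree_def
      connected_graph_def simple_graph_def by auto
  have "u = v" if "u \<in> verts T" "v \<in> verts T" for u v
    using conn[OF that] E by simp
  then have "\<And>u v. u \<in> S \<Longrightarrow> v \<in> S \<Longrightarrow> u = v" using S by blast
  moreover have "finite S" using S fin finite_subset by blast
  ultimately show ?thesis using card_le_Suc0_iff_eq by (metis One_nat_def)
qed

lemma kappa_edgeless:
  assumes "2 \<le> card S"
  shows "kappa (V, {}) S = 0"
proof -
  have "disjoint_tree_family (V, {}) S F \<longleftrightarrow> F = {}" for F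
    using edgeless_tree_connecting[of V S] assms unfolding disjoint_tree_family_def
    by (metis One_nat_def Suc_1 all_not_in_conv empty_iff not_less_eq_eq order_trans pairwise_empty)
  then show ?thesis by (simp add: kappa_def)
qed

lemma max_edges_set_nonempty:
  assumes "2 \<le> k" "k \<le> n"
  shows "{card (edges G) | G :: nat graph.
     simple_graph G \<and> card (verts G) = n \<and> kappa_bar k G \<le> l} \<noteq> {}"
proof -
  let ?G = "({..<n}, {}) :: nat graph"
  have "simple_graph ?G" by (simp add: simple_graph_def)
  moreover have "kappa_bar k ?G \<le> l"
  proof -
    let ?K = "{kappa ?G S | S. S \<subseteq> verts ?G \<and> card S = k}"
    have "?K \<subseteq> {0}"
      using assms by (auto simp: kappa_edgeless)
    moreover have "?K \<noteq> {}"
      using assms by (intro kappa_bar_set_nonempty) simp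
    ultimately have "?K = {0}" by (meson subset_singletonD)
    then show ?thesis unfolding kappa_bar_def by (simp only: Max_singleton le0)
  qed
  ultimately show ?thesis using card_lessThan by fastforce
qed

end

(*
  Let v be a vertex of minimum degree and W the set of the remaining n - 1 vertices. Only one tree
  connecting W can leave W, so up to that one tree the local connectivity of W is a packing of
  spanning trees of G - v. The packing theorem of Nash-Williams and Tutte, with one colour class
  allowed to use the edges at v for free, reduces a lower bound on it to an inequality for every
  partition of W. As the complement H of G has few edges, counting crossing edges through a
  system of representatives settles all partitions except those into two or three classes. For
  these the choice of v is needed: by the maximality of its degree in H, no other vertex can have
  a large degree in H.

  Conversely, either two nonadjacent vertices of degree l, of which every (n - 1)-set contains one,
  or the mere number of edges bounds the number of trees.
*)

theory Submission
  imports Defs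
begin

section \<open>Connectivity relative to a base relation\<close>

text \<open>Put m = n - 1, let H be the complement of G and ask for d + 1 trees. For a partition of
  W into r + 1 classes, the tree through v needs only \<open>merged Q\<close> - 1 crossing edges in
  W. This is at most the degree of v in H, and just as many edges of H lie outside W. The two
  cancel, so 2|H| <= r(2m - r - 1 - 2d) suffices. The right side is concave in r, hence smallest at
  an end of the range. For m = 2d and m = 2d + 1 the ends 1 and m - 1 allow |H| <= 0 and |H| <= d.
  For m = 2d + 2 the finest partition allows |H| <= m - 1, and for larger m it admits |H| <= 2m - 2d
  - 2, the value that matches two nonadjacent vertices of degree d. The coarse partitions are the
  obstacle: r = 2 misses the last value by one edge and r = 1 by m - d - 1 edges, because the count
  supposes that every edge of H inside W crosses. There the position of the edges of H has to be
  examined.\<close>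

text \<open>\<open>B\<close> stands for connections provided from outside the edge set. For
  symmetric \<open>B\<close> the closure is an equivalence, and its classes are the
  components.\<close>

definition linked :: "('a \<times> 'a) set \<Rightarrow> 'a set set \<Rightarrow> ('a \<times> 'a) set" where
  "linked B A = (B \<union> {(x, y). {x, y} \<in> A})\<^sup>*"

lemma linked_refl [simp]: "(x, x) \<in> linked B A"
  by (simp add: linked_def)

lemma linked_trans: "(x, y) \<in> linked B A \<Longrightarrow> (y, z) \<in> linked B A \<Longrightarrow> (x, z) \<in> linked B A"
  unfolding linked_def by (rule rtrancl_trans)

lemma linked_sym:
  assumes "sym B" "(x, y) \<in> linked B A"
  shows "(y, x) \<in> linked B A"
proof -
  have "sym (B \<union> {(x, y). {x, y} \<in> A})"
    using assms(1) by (auto simp: sym_def insert_commute)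
  then show ?thesis using assms(2) sym_rtrancl unfolding linked_def sym_def by blast
qed

lemma equiv_linked: "sym B \<Longrightarrow> equiv UNIV (linked B A)"
  by (auto intro!: equivI reflI symI transI intro: linked_sym linked_trans)

lemma linked_mono: "A \<subseteq> A' \<Longrightarrow> linked B A \<subseteq> linked B A'"
  unfolding linked_def by (intro rtrancl_mono) auto

lemma linked_edge: "{x, y} \<in> A \<Longrightarrow> (x, y) \<in> linked B A"
  unfolding linked_def by blast

lemma linked_base: "(x, y) \<in> B \<Longrightarrow> (x, y) \<in> linked B A"
  unfolding linked_def by blast

lemma linked_least:
  assumes "B \<subseteq> R" "\<And>x y. {x, y} \<in> A \<Longrightarrow> (x, y) \<in> R" "equiv UNIV R"
  shows "linked B A \<subseteq> R"
proof -
  have "(x, y) \<in> R" if "(x, y) \<in> linked B A" for x y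
    using that unfolding linked_def
  proof (induction rule: rtrancl_induct)
    case base
    then show ?case using assms(3) by (simp add: equiv_def refl_on_def)
  next
    case (step y z)
    then have "(y, z) \<in> R" using assms(1,2) by blast
    then show ?case using step.IH assms(3) by (meson equiv_def transD)
  qed
  then show ?thesis by auto
qed

text \<open>A path that uses the new edge several times can be shortened to one that uses it at most
  once, in one of its two directions.\<close>

lemma linked_insert_iff:
  assumes B: "sym B"
  shows "(u, w) \<in> linked B (insert {p, q} A) \<longleftrightarrow>
    (u, w) \<in> linked B A \<or> (u, p) \<in> linked B A \<and> (q, w) \<in> linked B A \<or>
    (u, q) \<in> linked B A \<and> (p, w) \<in> linked B A" (is "?L \<longleftrightarrow> ?R u w")
proof
  assume ?L
  then show "?R u w"
    unfolding linked_def[of B "insert {p, q} A"]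
  proof (induction rule: rtrancl_induct)
    case (step y z)
    consider "(y, z) \<in> linked B A" | "y = p" "z = q" | "y = q" "z = p"
      using step.hyps(2) by (auto simp: doubleton_eq_iff intro: linked_edge linked_base)
    then show ?case
    proof cases
      case 1
      then show ?thesis using step.IH by (blast intro: linked_trans)
    next
      case 2
      then show ?thesis using step.IH by auto
    next
      case 3
      then show ?thesis using step.IH by auto
    qed
  qed simp
next
  assume "?R u w"
  moreover have "linked B A \<subseteq> linked B (insert {p, q} A)" by (intro linked_mono) auto
  moreover have "(p, q) \<in> linked B (insert {p, q} A)" "(q, p) \<in> linked B (insert {p, q} A)"
    by (auto intro!: linked_edge simp: insert_commute)
  ultimately show ?L by (meson linked_trans subsetD)
qed

lemma linked_insert_absorb:
  assumes "sym B" "(p, q) \<in> linked B A"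
  shows "linked B (insert {p, q} A) = linked B A"
proof -
  have "(u, w) \<in> linked B A" if "(u, w) \<in> linked B (insert {p, q} A)" for u w
    using that linked_insert_iff[OF assms(1), of u w p q A] assms(2) linked_sym[OF assms]
      linked_trans by metis
  then show ?thesis using linked_mono[of A "insert {p, q} A" B] by auto
qed

text \<open>\<open>{x, y}\<close> lies on a cycle and a bridge lies on none, so the rest of the
  cycle survives the deletion of all bridges. They are deleted one by one, but each is a bridge of
  the whole of \<open>A\<close>.\<close>

lemma linked_remove_bridges:
  assumes B: "sym B" and "finite D" and D: "D \<subseteq> A" and e: "{x, y} \<in> A" "{x, y} \<notin> D"
    and xy: "(x, y) \<in> linked B (A - {{x, y}})"
    and br: "\<And>p q. {p, q} \<in> D \<Longrightarrow> (p, q) \<notin> linked B (A - {{p, q}})"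
    and two: "\<And>d. d \<in> D \<Longrightarrow> \<exists>p q. d = {p, q}"
  shows "(x, y) \<in> linked B (A - {{x, y}} - D)"
  using \<open>finite D\<close> D e(2) br two
proof (induction D rule: finite_induct)
  case empty
  then show ?case using xy by simp
next
  case (insert d D)
  from insert.prems(4)[OF insertI1] obtain p q where d: "d = {p, q}" by (elim exE)
  have IH: "(x, y) \<in> linked B (A - {{x, y}} - D)"
    using insert.prems by (intro insert.IH) (simp_all add: insertI2)
  let ?C = "A - {{x, y}} - insert d D"
  have "d \<in> A" "d \<noteq> {x, y}" using insert.prems(1,2) by auto
  then have "A - {{x, y}} - D = insert {p, q} ?C"
    using insert.hyps unfolding d(1) by blast
  then have ins: "(x, y) \<in> linked B (insert {p, q} ?C)" using IH by simp
  have CD: "linked B ?C \<subseteq> linked B (A - {{p, q}})" unfolding d(1) by (rule linked_mono) blast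
  \<comment> \<open>The edge \<open>{x, y}\<close> is still present here; it closes the detour from
    \<open>p\<close> to \<open>q\<close> that contradicts the bridge.\<close>
  have xy': "(x, y) \<in> linked B (A - {{p, q}})"
    using e(1) \<open>d \<noteq> {x, y}\<close> d by (intro linked_edge) simp
  have nb: "(p, q) \<notin> linked B (A - {{p, q}})"
    by (rule insert.prems(3)) (simp add: d(1))
  consider "(x, y) \<in> linked B ?C" | "(x, p) \<in> linked B ?C" "(q, y) \<in> linked B ?C"
    | "(x, q) \<in> linked B ?C" "(p, y) \<in> linked B ?C"
    using ins unfolding linked_insert_iff[OF B] by blast
  then show ?case
  proof cases
    case 1
    then show ?thesis .
  next
    case 2
    then have "(p, q) \<in> linked B (A - {{p, q}})"
      using CD xy' linked_sym[OF B] by (meson linked_trans subsetD)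
    then show ?thesis using nb by contradiction
  next
    case 3
    then have "(p, q) \<in> linked B (A - {{p, q}})"
      using CD xy' linked_sym[OF B] by (meson linked_trans subsetD)
    then show ?thesis using nb by contradiction
  qed
qed

lemma card_quotient_mono:
  assumes "finite W" "equiv UNIV R" "equiv UNIV R'" "R \<subseteq> R'"
  shows "card (W // R') \<le> card (W // R)"
proof -
  have "W // R' \<subseteq> (\<lambda>X. R' `` X) ` (W // R)"
  proof
    fix X assume "X \<in> W // R'"
    then obtain w where w: "w \<in> W" "X = R' `` {w}" by (auto elim: quotientE)
    have "R' `` (R `` {w}) = R' `` {w}"
    proof
      show "R' `` (R `` {w}) \<subseteq> R' `` {w}"
        using assms(3,4) by (auto simp: equiv_def dest: transD)
      show "R' `` {w} \<subseteq> R' `` (R `` {w})"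
        using assms(2) by (auto simp: equiv_def refl_on_def)
    qed
    then show "X \<in> (\<lambda>X. R' `` X) ` (W // R)" using w by (auto intro: quotientI)
  qed
  moreover have "finite (W // R)" using assms(1) by (simp add: quotient_def)
  ultimately show ?thesis by (rule surj_card_le[rotated])
qed

text \<open>The counting behind the insertion of an edge: the classes of its ends are both replaced
  by their union \<open>Z\<close>, which was no class before.\<close>

lemma card_image_merge:
  assumes W: "finite W" "p \<in> W" "q \<in> W" and pq: "g p \<noteq> g q" and Z: "Z \<notin> g ` W"
    and g': "\<And>w. g' w = (if g w = g p \<or> g w = g q then Z else g w)"
  shows "Suc (card (g' ` W)) = card (g ` W)"
proof -
  have "g' ` W = insert Z (g ` W - {g p, g q})"
  proof (intro set_eqI iffI)
    fix X assume "X \<in> g' ` W"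
    then show "X \<in> insert Z (g ` W - {g p, g q})" by (force simp: g' split: if_splits)
  next
    fix X assume X: "X \<in> insert Z (g ` W - {g p, g q})"
    have "g' p = Z" by (simp add: g')
    then have "Z \<in> g' ` W" using W(2) by blast
    moreover have "X \<in> g' ` W" if "X \<in> g ` W - {g p, g q}"
    proof -
      obtain w where "w \<in> W" "X = g w" using \<open>X \<in> g ` W - {g p, g q}\<close> by blast
      moreover from this have "g' w = g w" using \<open>X \<in> g ` W - {g p, g q}\<close> by (simp add: g')
      ultimately show ?thesis by (metis imageI)
    qed
    ultimately show "X \<in> g' ` W" using X by blast
  qed
  moreover have "card {g p, g q} = 2" using pq by simp
  moreover have "card {g p, g q} \<le> card (g ` W)" using W by (intro card_mono) auto
  ultimately show ?thesis using W Z by (simp add: card_Diff_subset)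
qed

lemma quotient_eq_image: "W // R = (\<lambda>w. R `` {w}) ` W"
  unfolding quotient_def by blast

lemma card_quotient_linked_insert:
  assumes B: "sym B" and W: "finite W" "p \<in> W" "q \<in> W" and pq: "(p, q) \<notin> linked B A"
  shows "Suc (card (W // linked B (insert {p, q} A))) = card (W // linked B A)"
proof -
  let ?R = "linked B A" and ?R' = "linked B (insert {p, q} A)"
  let ?P = "?R `` {p}" and ?Q = "?R `` {q}"
  have eq: "equiv UNIV ?R" by (rule equiv_linked[OF B])
  have same: "?R `` {w} = ?R `` {z} \<longleftrightarrow> (z, w) \<in> ?R" for w z
    by (metis UNIV_I eq eq_equiv_class_iff linked_sym[OF B])
  have cls: "?R' `` {w} = (if ?R `` {w} = ?P \<or> ?R `` {w} = ?Q then ?P \<union> ?Q else ?R `` {w})" for w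
  proof -
    have "(w, x) \<in> ?R' \<longleftrightarrow> (if (p, w) \<in> ?R \<or> (q, w) \<in> ?R then (p, x) \<in> ?R \<or> (q, x) \<in> ?R
      else (w, x) \<in> ?R)" for x
      using linked_insert_iff[OF B, of w x p q A] linked_sym[OF B, of _ _ A]
        linked_trans[of _ _ B A] by (smt (verit))
    then show ?thesis unfolding same by (intro set_eqI) (simp split: if_splits)
  qed
  show ?thesis
    unfolding quotient_eq_image
  proof (rule card_image_merge[OF W _ _ cls])
    show "?P \<noteq> ?Q" unfolding same using pq linked_sym[OF B] by blast
    show "?P \<union> ?Q \<notin> (\<lambda>w. ?R `` {w}) ` W"
    proof
      assume "?P \<union> ?Q \<in> (\<lambda>w. ?R `` {w}) ` W"
      then obtain w where w: "?P \<union> ?Q = ?R `` {w}" by (elim imageE)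
      have "p \<in> ?P \<union> ?Q" "q \<in> ?P \<union> ?Q" by simp_all
      then have "(w, p) \<in> ?R" "(w, q) \<in> ?R" unfolding w by simp_all
      then have "(p, q) \<in> ?R" by (blast intro: linked_sym[OF B] linked_trans)
      then show False using pq by simp
    qed
  qed
qed

lemma card_quotient_linked_insert_le:
  assumes "sym B" "finite W" "p \<in> W" "q \<in> W"
  shows "card (W // linked B A) \<le> Suc (card (W // linked B (insert {p, q} A)))"
proof (cases "(p, q) \<in> linked B A")
  case True
  show ?thesis unfolding linked_insert_absorb[OF assms(1) True] by simp
next
  case False
  show ?thesis unfolding card_quotient_linked_insert[OF assms False] by simp
qed

text \<open>An edge that is a bridge in the presence of all of \<open>D\<close> is one in the
  presence of a part of \<open>D\<close>. So each edge of \<open>D\<close>, when its turn comes,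
  joins two different components.\<close>

lemma card_quotient_linked_bridges:
  assumes B: "sym B" and W: "finite W" and "finite D"
    and two: "\<And>d. d \<in> D \<Longrightarrow> \<exists>p q. d = {p, q} \<and> p \<in> W \<and> q \<in> W"
    and br: "\<And>p q. {p, q} \<in> D \<Longrightarrow> (p, q) \<notin> linked B (A \<union> D - {{p, q}})"
    and AD: "A \<inter> D = {}"
  shows "card (W // linked B (A \<union> D)) + card D = card (W // linked B A)"
  using \<open>finite D\<close> two br AD
proof (induction D rule: finite_induct)
  case (insert d D)
  from insert.prems(1)[OF insertI1] obtain p q where d: "d = {p, q}" "p \<in> W" "q \<in> W"
    by (elim exE conjE)
  have IH: "card (W // linked B (A \<union> D)) + card D = card (W // linked B A)"
  proof (rule insert.IH)
    show "\<exists>p q. d = {p, q} \<and> p \<in> W \<and> q \<in> W" if "d \<in> D" for d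
      using that by (intro insert.prems(1)) simp
    show "(p', q') \<notin> linked B (A \<union> D - {{p', q'}})" if D: "{p', q'} \<in> D" for p' q'
    proof
      assume "(p', q') \<in> linked B (A \<union> D - {{p', q'}})"
      moreover have "linked B (A \<union> D - {{p', q'}}) \<subseteq> linked B (A \<union> insert d D - {{p', q'}})"
        by (rule linked_mono) blast
      ultimately have "(p', q') \<in> linked B (A \<union> insert d D - {{p', q'}})" by (rule rev_subsetD)
      then show False using insert.prems(2)[OF insertI2[OF D]] by contradiction
    qed
    show "A \<inter> D = {}" using insert.prems(3) by simp
  qed
  have "d \<notin> A" "d \<notin> D" using insert.hyps insert.prems(3) by auto
  then have "A \<union> insert d D - {{p, q}} = A \<union> D" unfolding d(1) by blast
  moreover have "{p, q} \<in> insert d D" using d(1) by simp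
  ultimately have "(p, q) \<notin> linked B (A \<union> D)" using insert.prems(2) by metis
  from card_quotient_linked_insert[OF B W d(2,3) this]
  have "Suc (card (W // linked B (A \<union> insert d D))) = card (W // linked B (A \<union> D))"
    by (simp add: d(1))
  then show ?case using IH insert.hyps by simp
qed simp

section \<open>Packing connected spanning subgraphs\<close>

definition pairs :: "'a set \<Rightarrow> 'a set set" where
  "pairs V = {e. e \<subseteq> V \<and> card e = 2}"

definition crossing :: "('a \<times> 'a) set \<Rightarrow> 'a set set \<Rightarrow> 'a set set" where
  "crossing Q X = {e \<in> X. \<exists>x y. e = {x, y} \<and> (x, y) \<notin> Q}"

lemma pairsE:
  assumes "e \<in> pairs V"
  obtains x y where "e = {x, y}" "x \<noteq> y" "x \<in> V" "y \<in> V"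
  using assms unfolding pairs_def card_2_iff by auto

lemma finite_pairs: "finite V \<Longrightarrow> finite (pairs V)"
  unfolding pairs_def by simp

text \<open>Colours are arbitrary natural numbers, but only those below \<open>k\<close> enter the
  cost. \<open>B i\<close> holds the connections that colour \<open>i\<close> has for free.\<close>

locale colouring =
  fixes W :: "'a set" and E :: "'a set set" and B :: "nat \<Rightarrow> ('a \<times> 'a) set" and k :: nat
  assumes finW: "finite W" and EW: "E \<subseteq> pairs W" and symB: "\<And>i. sym (B i)"
begin

definition colour :: "('a set \<Rightarrow> nat) \<Rightarrow> nat \<Rightarrow> 'a set set" where
  "colour f i = {e \<in> E. f e = i}"

text \<open>The edge lies on a cycle of its own colour, where steps along \<open>B\<close> count
  too, so it can leave that colour without splitting a component.\<close>

definition redundant :: "('a set \<Rightarrow> nat) \<Rightarrow> 'a \<Rightarrow> 'a \<Rightarrow> bool" where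
  "redundant f x y \<longleftrightarrow> {x, y} \<in> E \<and>
     (x, y) \<in> linked (B (f {x, y})) (colour f (f {x, y}) - {{x, y}})"

definition cost :: "('a set \<Rightarrow> nat) \<Rightarrow> nat" where
  "cost f = (\<Sum>i<k. card (W // linked (B i) (colour f i)))"

text \<open>Redundancy is tested in the current colouring \<open>g\<close>, not in \<open>f\<close>:
  the arrival of an edge can make other edges of its new colour redundant.\<close>

inductive moves :: "('a set \<Rightarrow> nat) \<Rightarrow> ('a set \<Rightarrow> nat) \<Rightarrow> bool" for f where
  start: "moves f f"
| step: "moves f g \<Longrightarrow> redundant g x y \<Longrightarrow> j < k \<Longrightarrow> moves f (g({x, y} := j))"

lemma finE: "finite E"
  using finite_subset[OF EW] finite_pairs[OF finW] .

lemma colour_upd: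
  assumes "e \<in> E" "j \<noteq> f e"
  shows "colour (f(e := j)) (f e) = colour f (f e) - {e}"
    "colour (f(e := j)) j = insert e (colour f j)"
    "i \<noteq> j \<Longrightarrow> i \<noteq> f e \<Longrightarrow> colour (f(e := j)) i = colour f i"
  using assms unfolding colour_def by auto

lemma redundant_linked:
  assumes "redundant f x y"
  shows "linked (B (f {x, y})) (colour f (f {x, y}) - {{x, y}}) = linked (B (f {x, y})) (colour f (f {x, y}))"
proof -
  let ?A = "colour f (f {x, y})"
  have "insert {x, y} (?A - {{x, y}}) = ?A"
    using assms unfolding redundant_def colour_def by auto
  moreover have "(x, y) \<in> linked (B (f {x, y})) (?A - {{x, y}})"
    using assms unfolding redundant_def by blast
  ultimately show ?thesis using linked_insert_absorb[OF symB] by metis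
qed

text \<open>The old colour keeps its components since the edge was redundant there; the new colour
  can only lose components, and loses one if the edge joins two of them.\<close>

lemma cost_move:
  assumes r: "redundant f x y" and j: "j < k" "j \<noteq> f {x, y}"
  shows "cost (f({x, y} := j)) \<le> cost f"
    and "(x, y) \<notin> linked (B j) (colour f j) \<Longrightarrow> cost (f({x, y} := j)) < cost f"
proof -
  let ?f' = "f({x, y} := j)"
  have e: "{x, y} \<in> E" using r unfolding redundant_def by simp
  then have xy: "x \<in> W" "y \<in> W" using EW unfolding pairs_def by auto
  have same: "linked (B i) (colour ?f' i) = linked (B i) (colour f i)" if "i \<noteq> j" for i
    using colour_upd[where f = f, OF e j(2)] redundant_linked[OF r] that by (cases "i = f {x, y}") auto
  have le: "card (W // linked (B j) (colour ?f' j)) \<le> card (W // linked (B j) (colour f j))"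
    unfolding colour_upd(2)[where f = f, OF e j(2)]
    by (intro card_quotient_mono finW equiv_linked symB linked_mono) auto
  have split: "cost g = card (W // linked (B j) (colour g j)) +
      (\<Sum>i\<in>{..<k} - {j}. card (W // linked (B i) (colour g i)))" for g
    unfolding cost_def using j(1) by (simp add: sum.remove)
  have rest: "(\<Sum>i\<in>{..<k} - {j}. card (W // linked (B i) (colour ?f' i))) =
      (\<Sum>i\<in>{..<k} - {j}. card (W // linked (B i) (colour f i)))"
    by (intro sum.cong refl) (simp add: same)
  show "cost ?f' \<le> cost f" unfolding split[of ?f'] split[of f] rest using le by simp
  assume "(x, y) \<notin> linked (B j) (colour f j)"
  from card_quotient_linked_insert[OF symB finW xy this]
  have "card (W // linked (B j) (colour ?f' j)) < card (W // linked (B j) (colour f j))"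
    unfolding colour_upd(2)[where f = f, OF e j(2)] by simp
  then show "cost ?f' < cost f" unfolding split[of ?f'] split[of f] rest by simp
qed

lemma redundant_sym: "redundant f x y \<Longrightarrow> redundant f y x"
  unfolding redundant_def by (simp add: insert_commute linked_sym[OF symB])

definition free_edges :: "('a set \<Rightarrow> nat) \<Rightarrow> 'a set set" where
  "free_edges f = {{x, y} | x y. \<exists>g. moves f g \<and> redundant g x y}"

lemma free_edgesI: "moves f g \<Longrightarrow> redundant g x y \<Longrightarrow> {x, y} \<in> free_edges f"
  unfolding free_edges_def by blast

text \<open>All edges of a cycle are redundant, so a redundant edge stays spanned by free edges.\<close>

lemma redundant_linked_free:
  assumes m: "moves f g" and r: "redundant g x y"
  shows "(x, y) \<in> linked (B (g {x, y})) (colour g (g {x, y}) \<inter> free_edges f - {{x, y}})"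
proof -
  let ?i = "g {x, y}"
  let ?A = "colour g ?i"
  let ?D = "?A - free_edges f"
  have "(x, y) \<in> linked (B ?i) (?A - {{x, y}} - ?D)"
  proof (rule linked_remove_bridges[OF symB])
    show "finite ?D" using finE unfolding colour_def by simp
    show "{x, y} \<in> ?A" using r unfolding redundant_def colour_def by simp
    show "{x, y} \<notin> ?D" using free_edgesI[OF m r] by simp
    show "(x, y) \<in> linked (B ?i) (?A - {{x, y}})" using r unfolding redundant_def by simp
    show "(p, q) \<notin> linked (B ?i) (?A - {{p, q}})" if D: "{p, q} \<in> ?D" for p q
    proof
      assume "(p, q) \<in> linked (B ?i) (?A - {{p, q}})"
      moreover have "{p, q} \<in> E" "g {p, q} = ?i" using D unfolding colour_def by auto
      ultimately have "redundant g p q" unfolding redundant_def by simp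
      then show False using free_edgesI[OF m] D by blast
    qed
    show "\<exists>p q. d = {p, q}" if "d \<in> ?D" for d
    proof -
      have "d \<in> pairs W" using that EW unfolding colour_def by auto
      then show ?thesis by (elim pairsE) blast
    qed
  qed auto
  moreover have "?A - {{x, y}} - ?D = ?A \<inter> free_edges f - {{x, y}}" by auto
  ultimately show ?thesis by simp
qed

lemma moves_cost:
  assumes "\<And>g. cost f \<le> cost g" "moves f g"
  shows "cost g = cost f"
  using assms(2)
proof induction
  case (step g x y j)
  have "cost (g({x, y} := j)) \<le> cost g"
    using cost_move(1)[OF step.hyps(2,3)] by (cases "j = g {x, y}") auto
  then show ?case using step.IH assms(1)[of "g({x, y} := j)"] by linarith
qed simp

text \<open>In its new colour the edge cannot join two components, as this would push the cost below
  the minimum. So it closes a cycle there.\<close>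

lemma redundant_move:
  assumes min: "\<And>g. cost f \<le> cost g" and m: "moves f g" and r: "redundant g x y" and j: "j < k"
  shows "redundant (g({x, y} := j)) x y"
proof (cases "j = g {x, y}")
  case True
  then show ?thesis using r by simp
next
  case False
  have e: "{x, y} \<in> E" using r unfolding redundant_def by simp
  have "\<not> cost (g({x, y} := j)) < cost g"
    using moves_cost[OF min] moves.step[OF m r j] m by simp
  then have "(x, y) \<in> linked (B j) (colour g j)"
    using cost_move(2)[OF r j False] by blast
  moreover have "colour (g({x, y} := j)) j - {{x, y}} = colour g j"
    unfolding colour_upd(2)[where f = g, OF e False] using False by (auto simp: colour_def)
  ultimately show ?thesis using e unfolding redundant_def by simp
qed

text \<open>The moved edge is redundant before and after the move. Hence in both colours concerned
  the other free edges already connect its ends, and neither its departure nor its arrival changes a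
  component.\<close>

lemma linked_free_invariant:
  assumes min: "\<And>g. cost f \<le> cost g" and "moves f g"
  shows "linked (B i) (colour g i \<inter> free_edges f) = linked (B i) (colour f i \<inter> free_edges f)"
  using assms(2)
proof induction
  case (step g x y j)
  let ?e = "{x, y}" and ?g = "g({x, y} := j)" and ?F = "free_edges f"
  have e: "?e \<in> E" using step.hyps unfolding redundant_def by simp
  have eF: "?e \<in> ?F" using free_edgesI[OF step.hyps(1,2)] .
  have "linked (B i) (colour ?g i \<inter> ?F) = linked (B i) (colour g i \<inter> ?F)"
  proof (cases "j = g ?e")
    case True
    then show ?thesis by simp
  next
    case False
    consider "i = g ?e" | "i = j" | "i \<noteq> g ?e" "i \<noteq> j" by blast
    then show ?thesis
    proof cases
      case 1
      have "colour ?g i \<inter> ?F = colour g i \<inter> ?F - {?e}"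
        unfolding 1 colour_upd(1)[where f = g, OF e False] by auto
      moreover have "insert ?e (colour g i \<inter> ?F - {?e}) = colour g i \<inter> ?F"
        using e eF 1 unfolding colour_def by auto
      ultimately show ?thesis
        using linked_insert_absorb[OF symB redundant_linked_free[OF step.hyps(1,2)]] 1 by simp
    next
      case 2
      have r: "redundant ?g x y" using redundant_move[OF min step.hyps] .
      have m: "moves f ?g" using moves.step[OF step.hyps] .
      have "colour ?g i \<inter> ?F = insert ?e (colour g i \<inter> ?F)"
        unfolding 2 colour_upd(2)[where f = g, OF e False] using eF by auto
      moreover have "colour ?g i \<inter> ?F - {?e} = colour g i \<inter> ?F"
        unfolding 2 colour_upd(2)[where f = g, OF e False] using False by (auto simp: colour_def)
      ultimately show ?thesis
        using linked_insert_absorb[OF symB redundant_linked_free[OF m r]] 2 by simp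
    next
      case 3
      then show ?thesis using colour_upd(3)[where f = g, OF e False] by simp
    qed
  qed
  then show ?case using step.IH by (rule trans)
qed simp

text \<open>The crucial property: a free edge is spanned by the free edges of every colour, not just
  of its own. Move it to colour \<open>j\<close>, where it is redundant again, and carry the
  connection back to \<open>f\<close> by invariance.\<close>

lemma free_linked:
  assumes min: "\<And>g. cost f \<le> cost g" and e: "{x, y} \<in> free_edges f" and j: "j < k"
  shows "(x, y) \<in> linked (B j) (colour f j \<inter> free_edges f)"
proof -
  obtain x' y' g where xy': "{x, y} = {x', y'}" and m: "moves f g" and "redundant g x' y'"
    using e unfolding free_edges_def by blast
  then have r: "redundant g x y" using redundant_sym unfolding doubleton_eq_iff by blast
  let ?g = "g({x, y} := j)"
  have r': "redundant ?g x y" using redundant_move[OF min m r j] .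
  have m': "moves f ?g" using moves.step[OF m r j] .
  have "(x, y) \<in> linked (B j) (colour ?g j \<inter> free_edges f - {{x, y}})"
    using redundant_linked_free[OF m' r'] by simp
  then have "(x, y) \<in> linked (B j) (colour ?g j \<inter> free_edges f)"
    using linked_mono[of "colour ?g j \<inter> free_edges f - {{x, y}}" "colour ?g j \<inter> free_edges f"] by blast
  then show ?thesis using linked_free_invariant[OF min m'] by simp
qed

text \<open>An edge that is not free is in particular not redundant in \<open>f\<close>, hence a
  bridge of its colour.\<close>

lemma card_quotient_free:
  "card (W // linked (B i) (colour f i)) + card (colour f i - free_edges f) =
    card (W // linked (B i) (colour f i \<inter> free_edges f))"
proof -
  let ?A = "colour f i \<inter> free_edges f" and ?D = "colour f i - free_edges f"
  have AD: "?A \<union> ?D = colour f i" by auto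
  have "card (W // linked (B i) (?A \<union> ?D)) + card ?D = card (W // linked (B i) ?A)"
  proof (rule card_quotient_linked_bridges[OF symB finW])
    show "finite ?D" using finE unfolding colour_def by simp
    show "\<exists>p q. d = {p, q} \<and> p \<in> W \<and> q \<in> W" if "d \<in> ?D" for d
    proof -
      have "d \<in> pairs W" using that EW unfolding colour_def by auto
      then show ?thesis by (elim pairsE) blast
    qed
    show "(p, q) \<notin> linked (B i) (?A \<union> ?D - {{p, q}})" if D: "{p, q} \<in> ?D" for p q
      unfolding AD
    proof
      assume "(p, q) \<in> linked (B i) (colour f i - {{p, q}})"
      moreover have "{p, q} \<in> E" "f {p, q} = i" using D unfolding colour_def by auto
      ultimately have "redundant f p q" unfolding redundant_def by simp
      then show False using free_edgesI[OF moves.start] D by blast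
    qed
  qed auto
  then show ?thesis unfolding AD .
qed

end

text \<open>
  A form of the theorem of Nash-Williams and Tutte in which colour \<open>i\<close> may use the relation
  \<open>B i\<close> for free. In a colouring minimising the total number of components, the components of
  the edges that some sequence of recolourings makes redundant form the critical partition.
\<close>

theorem connected_packing:
  assumes finW: "finite W" and W: "W \<noteq> {}" and EW: "E \<subseteq> pairs W" and symB: "\<And>i. sym (B i)"
    and k: "0 < k"
    and crit: "\<And>Q. equiv UNIV Q \<Longrightarrow>
      (\<Sum>i<k. card (W // (Q \<union> B i)\<^sup>*)) \<le> card (crossing Q E) + k"
  obtains f where "\<And>i. i < k \<Longrightarrow> W \<times> W \<subseteq> linked (B i) {e \<in> E. f e = i}"
proof -
  interpret colouring W E B k by unfold_locales (fact finW EW symB)+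
  obtain f0 where f0: "\<And>g. cost f0 \<le> cost g"
    using ex_has_least_nat[of "\<lambda>_. True" _ cost] by blast
  \<comment> \<open>A colour from \<open>k\<close> on counts for nothing. Recolouring such edges by
    \<open>0\<close> does not raise the cost, and the colours below \<open>k\<close> then cover
    \<open>E\<close>.\<close>
  define f where "f e = (if f0 e < k then f0 e else 0)" for e
  have "cost f \<le> cost f0"
    unfolding cost_def
  proof (intro sum_mono card_quotient_mono finW equiv_linked symB linked_mono)
    show "colour f0 i \<subseteq> colour f i" if "i \<in> {..<k}" for i
      using that unfolding colour_def f_def by auto
  qed
  then have min: "cost f \<le> cost g" for g using f0 order_trans by blast
  have range: "f ` E \<subseteq> {..<k}" using k unfolding f_def by auto
  let ?F = "free_edges f"
  let ?Q = "linked {} ?F"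
  have Q: "equiv UNIV ?Q" by (rule equiv_linked) (simp add: sym_def)
  \<comment> \<open>By \<open>free_linked\<close> the free edges of the single colour
    \<open>i\<close> connect as much as all free edges together.\<close>
  have QB: "card (W // linked (B i) (colour f i \<inter> ?F)) \<le> card (W // (?Q \<union> B i)\<^sup>*)" if "i < k" for i
  proof (intro card_quotient_mono finW equiv_linked symB)
    let ?L = "linked (B i) (colour f i \<inter> ?F)"
    have L: "equiv UNIV ?L" by (rule equiv_linked[OF symB])
    have "?Q \<subseteq> ?L" by (intro linked_least L free_linked[OF min _ that]) auto
    moreover have "B i \<subseteq> ?L" by (auto intro: linked_base)
    ultimately have "(?Q \<union> B i)\<^sup>* \<subseteq> ?L\<^sup>*" by (intro rtrancl_mono) simp
    then show "(?Q \<union> B i)\<^sup>* \<subseteq> ?L" unfolding linked_def by simp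
    have "sym (?Q \<union> B i)" using Q symB[of i] by (simp add: sym_Un equiv_def)
    then show "equiv UNIV ((?Q \<union> B i)\<^sup>*)"
      by (intro equivI refl_rtrancl sym_rtrancl trans_rtrancl) auto
  qed
  have cross: "crossing ?Q E \<subseteq> E - ?F"
    unfolding crossing_def by (auto intro: linked_edge)
  have "cost f + card (E - ?F) = (\<Sum>i<k. card (W // linked (B i) (colour f i \<inter> ?F)))"
  proof -
    have "E - ?F = (\<Union>i<k. colour f i - ?F)"
      using range unfolding colour_def by auto
    then have "card (E - ?F) = card (\<Union>i<k. colour f i - ?F)" by simp
    also have "\<dots> = (\<Sum>i<k. card (colour f i - ?F))"
      using finE by (intro card_UN_disjoint) (auto simp: colour_def)
    finally show ?thesis
      unfolding cost_def by (simp add: sum.distrib[symmetric] card_quotient_free)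
  qed
  also have "\<dots> \<le> (\<Sum>i<k. card (W // (?Q \<union> B i)\<^sup>*))"
    by (intro sum_mono QB) simp
  also have "\<dots> \<le> card (crossing ?Q E) + k" by (rule crit[OF Q])
  also have "\<dots> \<le> card (E - ?F) + k"
    using card_mono[OF _ cross] finE by simp
  finally have cost: "cost f \<le> k" by simp
  \<comment> \<open>The cost is a sum of \<open>k\<close> terms, each at least 1, so a cost of at
    most \<open>k\<close> forces every term to be 1.\<close>
  have pos: "1 \<le> card (W // linked (B i) (colour f i))" for i
    using W finW by (simp add: quotient_eq_image Suc_le_eq card_gt_0_iff)
  show ?thesis
  proof
    fix i assume i: "i < k"
    have "card (W // linked (B i) (colour f i)) = 1"
    proof (rule ccontr)
      assume "card (W // linked (B i) (colour f i)) \<noteq> 1"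
      then have "1 < card (W // linked (B i) (colour f i))" using pos[of i] by simp
      then have "(\<Sum>i<k. 1) < cost f"
        unfolding cost_def using i pos by (intro sum_strict_mono_ex1) auto
      then show False using cost by simp
    qed
    then obtain C where C: "W // linked (B i) (colour f i) = {C}" by (auto simp: card_1_singleton_iff)
    show "W \<times> W \<subseteq> linked (B i) {e \<in> E. f e = i}"
    proof (rule subrelI)
      fix x y assume "(x, y) \<in> W \<times> W"
      then have "linked (B i) (colour f i) `` {x} = C" "linked (B i) (colour f i) `` {y} = C"
        using C unfolding quotient_eq_image by auto
      then have "(x, y) \<in> linked (B i) (colour f i)"
        using equiv_linked[OF symB] by (metis Image_singleton_iff linked_refl)
      then show "(x, y) \<in> linked (B i) {e \<in> E. f e = i}" unfolding colour_def .
    qed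
  qed
qed

section \<open>Trees and local connectivity\<close>

lemma simple_graph_iff_pairs: "simple_graph (V, A) \<longleftrightarrow> finite V \<and> A \<subseteq> pairs V"
  unfolding simple_graph_def pairs_def by auto

lemma simple_graph_finite_edges: "simple_graph (V, A) \<Longrightarrow> finite A"
  unfolding simple_graph_iff_pairs using finite_pairs finite_subset by blast

lemma connected_graph_iff_linked:
  "connected_graph (V, A) \<longleftrightarrow> V \<noteq> {} \<and> V \<times> V \<subseteq> linked {} A"
  unfolding connected_graph_def linked_def by auto

text \<open>The list itself is a path between the ends of the closing edge.\<close>

lemma cycle_linked:
  assumes "is_cycle (V, A) c"
  shows "{hd c, last c} \<in> A" "(hd c, last c) \<in> linked {} (A - {{hd c, last c}})"
proof -
  have c: "3 \<le> length c" "distinct c" "{last c, hd c} \<in> A"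
    and path: "\<And>i. Suc i < length c \<Longrightarrow> {c ! i, c ! Suc i} \<in> A"
    using assms unfolding is_cycle_def by auto
  then have ne: "c \<noteq> []" by auto
  show "{hd c, last c} \<in> A" using c(3) by (simp add: insert_commute)
  have "(c ! 0, c ! i) \<in> linked {} (A - {{hd c, last c}})" if "i < length c" for i
    using that
  proof (induction i)
    case (Suc i)
    \<comment> \<open>This is where a length of at least 3 matters: no step of the path is the
      closing edge.\<close>
    have "{c ! i, c ! Suc i} \<noteq> {c ! 0, c ! (length c - 1)}"
    proof
      assume "{c ! i, c ! Suc i} = {c ! 0, c ! (length c - 1)}"
      then have "c ! i = c ! 0 \<and> c ! Suc i = c ! (length c - 1) \<or> c ! i = c ! (length c - 1)"
        unfolding doubleton_eq_iff by blast
      moreover have "0 < length c" "i < length c" "length c - 1 < length c"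
        using Suc.prems c(1) by linarith+
      ultimately have "i = 0 \<and> Suc i = length c - 1 \<or> i = length c - 1"
        using nth_eq_iff_index_eq[OF c(2)] Suc.prems by blast
      then show False using Suc.prems c(1) by linarith
    qed
    then have "{c ! i, c ! Suc i} \<in> A - {{hd c, last c}}"
      using path[OF Suc.prems] ne by (simp add: hd_conv_nth last_conv_nth)
    then show ?case using Suc by (meson Suc_lessD linked_edge linked_trans)
  qed simp
  then show "(hd c, last c) \<in> linked {} (A - {{hd c, last c}})"
    using ne by (simp add: hd_conv_nth last_conv_nth)
qed

text \<open>A connected spanning edge set of minimum size has no cycle, since the closing edge of a
  cycle could be dropped.\<close>

lemma spanning_tree_exists:
  assumes "simple_graph (V, A)" "connected_graph (V, A)"
  obtains A' where "A' \<subseteq> A" "is_tree (V, A')"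
proof -
  let ?P = "\<lambda>X. X \<subseteq> A \<and> connected_graph (V, X)"
  obtain X where X: "?P X" and least: "\<And>Y. ?P Y \<Longrightarrow> card X \<le> card Y"
    using ex_has_least_nat[of ?P A card] assms(2) by blast
  have fin: "finite X"
    using X assms(1) finite_pairs finite_subset unfolding simple_graph_iff_pairs by metis
  have "\<not> is_cycle (V, X) c" for c
  proof
    assume c: "is_cycle (V, X) c"
    let ?e = "{hd c, last c}"
    have "linked {} (insert ?e (X - {?e})) = linked {} (X - {?e})"
      using linked_insert_absorb[OF _ cycle_linked(2)[OF c]] by (simp add: sym_def)
    then have "linked {} (X - {?e}) = linked {} X"
      using cycle_linked(1)[OF c] by (simp add: insert_absorb)
    then have "?P (X - {?e})" using X unfolding connected_graph_iff_linked by auto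
    then have "card X \<le> card (X - {?e})" by (rule least)
    then show False using card_Diff1_less[OF fin cycle_linked(1)[OF c]] by simp
  qed
  then have "is_tree (V, X)"
    using X assms(1) unfolding is_tree_def simple_graph_iff_pairs by blast
  then show ?thesis using X that by blast
qed

lemma card_le_components_edges:
  assumes "finite V" "finite A" "A \<subseteq> pairs V"
  shows "card V \<le> card (V // linked {} A) + card A"
  using assms(2,3)
proof (induction A rule: finite_induct)
  case empty
  have "linked {} {} `` {w} = {w}" for w :: 'a unfolding linked_def by simp
  then show ?case by (simp add: quotient_eq_image card_image)
next
  case (insert e A)
  then have "e \<in> pairs V" by simp
  then obtain x y where e: "e = {x, y}" "x \<in> V" "y \<in> V" by (elim pairsE)
  have "card (V // linked {} A) \<le> Suc (card (V // linked {} (insert e A)))"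
    unfolding e(1) by (rule card_quotient_linked_insert_le) (use assms(1) e in \<open>auto simp: sym_def\<close>)
  then show ?case using insert by simp
qed

lemma connected_graph_card_edges:
  assumes "simple_graph (V, A)" "connected_graph (V, A)"
  shows "card V \<le> Suc (card A)"
proof -
  have V: "finite V" "A \<subseteq> pairs V" using assms(1) unfolding simple_graph_iff_pairs by auto
  obtain v where v: "v \<in> V" using assms(2) unfolding connected_graph_iff_linked by blast
  have sub: "V \<times> V \<subseteq> linked {} A" using assms(2) unfolding connected_graph_iff_linked by simp
  have eq: "equiv UNIV (linked {} A)" by (rule equiv_linked) (simp add: sym_def)
  have "V // linked {} A \<subseteq> {linked {} A `` {v}}"
    using sub v equiv_class_eq[OF eq] unfolding quotient_eq_image by auto
  then have "card (V // linked {} A) \<le> 1"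
    using card_mono[of "{linked {} A `` {v}}"] by simp
  moreover have "finite A" using V finite_pairs finite_subset by blast
  ultimately show ?thesis using card_le_components_edges[OF V(1) _ V(2)] by simp
qed

section \<open>Families of internally disjoint trees and the connectivity parameters\<close>

lemma disjoint_tree_familyD:
  assumes "disjoint_tree_family (V, E) S F" "T \<in> F"
  shows "simple_graph T" "connected_graph T" "S \<subseteq> verts T" "verts T \<subseteq> V" "edges T \<subseteq> E"
  using assms unfolding disjoint_tree_family_def tree_connecting_def subgraph_def is_tree_def by auto

lemma disjoint_tree_family_edges:
  assumes "disjoint_tree_family G S F" "T \<in> F" "T' \<in> F" "T \<noteq> T'"
  shows "edges T \<inter> edges T' = {}" "verts T \<inter> verts T' = S"
  using assms unfolding disjoint_tree_family_def pairwise_def internally_disjoint_def by auto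

lemma disjoint_tree_family_finite:
  assumes "simple_graph (V, E)" "disjoint_tree_family (V, E) S F"
  shows "finite F"
proof -
  have "F \<subseteq> Pow V \<times> Pow E"
  proof
    fix T assume "T \<in> F"
    then show "T \<in> Pow V \<times> Pow E"
      using disjoint_tree_familyD(4,5)[OF assms(2)] by (simp add: mem_Times_iff)
  qed
  moreover have "finite (Pow V \<times> Pow E)"
    using assms(1) simple_graph_finite_edges[OF assms(1)] unfolding simple_graph_iff_pairs by simp
  ultimately show ?thesis by (rule finite_subset)
qed

lemma connected_graph_edge_at:
  assumes "simple_graph T" "connected_graph T" "x \<in> verts T" "2 \<le> card (verts T)"
  obtains e where "e \<in> edges T" "x \<in> e"
proof -
  obtain y where y: "y \<in> verts T" "y \<noteq> x"
    using assms(3,4) by (metis One_nat_def Suc_1 card_le_Suc0_iff_eq assms(1) simple_graph_def not_less_eq_eq)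
  have "(x, y) \<in> {(x, y). {x, y} \<in> edges T}\<^sup>*"
    using assms(2,3) y(1) unfolding connected_graph_def by blast
  then obtain z where "{x, z} \<in> edges T"
    using y(2) by (auto elim: converse_rtranclE)
  then show ?thesis using that by blast
qed

text \<open>Every tree reaches \<open>x\<close> through an edge of its own.\<close>

lemma card_disjoint_trees_le_degree:
  assumes G: "simple_graph (V, E)" and F: "disjoint_tree_family (V, E) S F"
    and x: "x \<in> S" and S: "2 \<le> card S"
  shows "card F \<le> card {e \<in> E. x \<in> e}"
proof -
  have "\<exists>e. e \<in> edges T \<and> x \<in> e" if T: "T \<in> F" for T
  proof -
    have "finite (verts T)" using disjoint_tree_familyD(1)[OF F T] unfolding simple_graph_def by simp
    then have "2 \<le> card (verts T)"
      using S card_mono disjoint_tree_familyD(3)[OF F T] order_trans by metis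
    then show ?thesis
      using connected_graph_edge_at disjoint_tree_familyD(1-3)[OF F T] x by (meson connected_graph_edge_at subsetD)
  qed
  then obtain g where g: "\<And>T. T \<in> F \<Longrightarrow> g T \<in> edges T \<and> x \<in> g T" by metis
  show ?thesis
  proof (rule card_inj_on_le)
    show "inj_on g F"
    proof (rule inj_onI, rule ccontr)
      fix T T' assume T: "T \<in> F" "T' \<in> F" "g T = g T'" "T \<noteq> T'"
      then have "g T \<in> edges T \<inter> edges T'" using g[OF T(1)] g[OF T(2)] by simp
      then show False using disjoint_tree_family_edges(1)[OF F T(1,2,4)] by simp
    qed
    show "g ` F \<subseteq> {e \<in> E. x \<in> e}"
      using g disjoint_tree_familyD(5)[OF F] by (intro image_subsetI) blast
    show "finite {e \<in> E. x \<in> e}"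
      using simple_graph_finite_edges[OF G] by simp
  qed
qed

text \<open>At most one of the trees leaves \<open>V - {v}\<close>, and that one has an additional edge.\<close>

lemma disjoint_trees_count:
  assumes G: "simple_graph (V, E)" and F: "disjoint_tree_family (V, E) (V - {v}) F"
    and v: "v \<in> V"
  shows "card F * (card V - 2) \<le> card {e \<in> E. v \<notin> e} \<or> card F * (card V - 2) < card E"
proof -
  have fV: "finite V" and EV: "E \<subseteq> pairs V" using G unfolding simple_graph_iff_pairs by auto
  have fE: "finite E" using EV finite_pairs[OF fV] finite_subset by blast
  have fF: "finite F" using disjoint_tree_family_finite[OF G F] .
  have verts: "verts T = V - {v} \<or> verts T = V" if "T \<in> F" for T
    using disjoint_tree_familyD(3)[OF F that] disjoint_tree_familyD(4)[OF F that] by blast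
  have edges: "card (verts T) - 1 \<le> card (edges T)" if "T \<in> F" for T
    using connected_graph_card_edges[of "verts T" "edges T"] disjoint_tree_familyD(1,2)[OF F that]
    by simp
  have ge: "card V - 2 \<le> card (edges T)" if "T \<in> F" for T
  proof -
    have "card V - 1 \<le> card (verts T)"
      using verts[OF that] fV v by (elim disjE) simp_all
    then show ?thesis using edges[OF that] by linarith
  qed
  have UN: "(\<Sum>T\<in>F. card (edges T)) = card (\<Union>T\<in>F. edges T)"
  proof (rule card_UN_disjoint[symmetric, OF fF])
    show "\<forall>T\<in>F. finite (edges T)"
      using disjoint_tree_familyD(5)[OF F] fE finite_subset by blast
    show "\<forall>T\<in>F. \<forall>T'\<in>F. T \<noteq> T' \<longrightarrow> edges T \<inter> edges T' = {}"
      by (intro ballI impI disjoint_tree_family_edges(1)[OF F])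
  qed
  have sum: "card F * (card V - 2) = (\<Sum>T\<in>F. card V - 2)" by simp
  show ?thesis
  proof (cases "\<exists>T\<in>F. v \<in> verts T")
    case True
    then obtain T0 where T0: "T0 \<in> F" "v \<in> verts T0" by blast
    show ?thesis
    proof (cases "2 \<le> card V")
      case True
      have "verts T0 = V" using verts[OF T0(1)] T0(2) by auto
      then have "card V - 2 < card (edges T0)" using edges[OF T0(1)] True by simp
      then have "card F * (card V - 2) < (\<Sum>T\<in>F. card (edges T))"
        unfolding sum using ge T0(1) fF by (intro sum_strict_mono_ex1) auto
      also have "\<dots> \<le> card E"
        unfolding UN using disjoint_tree_familyD(5)[OF F] fE by (intro card_mono) auto
      finally show ?thesis by simp
    qed simp
  next
    case False
    have "(\<Sum>T\<in>F. card V - 2) \<le> (\<Sum>T\<in>F. card (edges T))" using ge by (intro sum_mono)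
    also have "\<dots> \<le> card {e \<in> E. v \<notin> e}"
      unfolding UN
    proof (intro card_mono)
      show "(\<Union>T\<in>F. edges T) \<subseteq> {e \<in> E. v \<notin> e}"
        using False disjoint_tree_familyD(1,5)[OF F] unfolding simple_graph_def by blast
    qed (use fE in simp)
    finally show ?thesis unfolding sum by simp
  qed
qed

lemma kappa_leI:
  assumes "simple_graph G" "\<And>F. disjoint_tree_family G S F \<Longrightarrow> card F \<le> l"
  shows "kappa G S \<le> l"
  unfolding kappa_def
  using assms(2) by (intro Max.boundedI[OF kappa_set_finite[OF assms(1)] kappa_set_nonempty]) auto

lemma kappa_geI:
  assumes "simple_graph G" "disjoint_tree_family G S F"
  shows "card F \<le> kappa G S"
  unfolding kappa_def using kappa_set_finite[OF assms(1)] assms(2) by (intro Max_ge) auto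

lemma kappa_bar_leI:
  assumes "simple_graph G" "k \<le> card (verts G)"
    "\<And>S. S \<subseteq> verts G \<Longrightarrow> card S = k \<Longrightarrow> kappa G S \<le> l"
  shows "kappa_bar k G \<le> l"
  unfolding kappa_bar_def
  using assms(3)
  by (intro Max.boundedI[OF kappa_bar_set_finite[OF assms(1)] kappa_bar_set_nonempty[OF assms(2)]]) auto

lemma kappa_bar_geI:
  assumes "simple_graph G" "S \<subseteq> verts G" "card S = k"
  shows "kappa G S \<le> kappa_bar k G"
  unfolding kappa_bar_def using kappa_bar_set_finite[OF assms(1)] assms(2,3) by (intro Max_ge) auto

lemma card_pred_subsetE:
  assumes "finite V" "S \<subseteq> V" "card S = card V - 1" "V \<noteq> {}"
  obtains v where "v \<in> V" "S = V - {v}"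
proof -
  have "card (V - S) = 1"
    using assms by (simp add: card_Diff_subset finite_subset card_gt_0_iff Suc_leI)
  then obtain v where "V - S = {v}" by (auto simp: card_1_singleton_iff)
  then show ?thesis using that[of v] assms(2) by auto
qed

lemma kappa_bar_pred_leI:
  assumes G: "simple_graph (V, E)" and V: "V \<noteq> {}"
    and le: "\<And>v F. v \<in> V \<Longrightarrow> disjoint_tree_family (V, E) (V - {v}) F \<Longrightarrow> card F \<le> l"
  shows "kappa_bar (card V - 1) (V, E) \<le> l"
proof (rule kappa_bar_leI[OF G])
  fix S assume "S \<subseteq> verts (V, E)" "card S = card V - 1"
  then obtain v where "v \<in> V" "S = V - {v}"
    using card_pred_subsetE[of V S] G V unfolding simple_graph_def by auto
  then show "kappa (V, E) S \<le> l" using le by (intro kappa_leI[OF G]) auto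
qed simp

text \<open>The free relation \<open>N \<times> N\<close> of colour \<open>0\<close> is realised by the edges at \<open>v\<close>.\<close>

lemma kappa_ge_packing:
  fixes V :: "'a set"
  assumes G: "simple_graph (V, E)" and v: "v \<in> V" and V: "3 \<le> card V"
    and f: "\<And>i. i < k \<Longrightarrow> (V - {v}) \<times> (V - {v}) \<subseteq>
      linked (if i = 0 then {w. {v, w} \<in> E} \<times> {w. {v, w} \<in> E} else {}) {e \<in> E. v \<notin> e \<and> f e = i}"
  shows "k \<le> kappa_bar (card V - 1) (V, E)"
proof -
  let ?W = "V - {v}" and ?N = "{w. {v, w} \<in> E}"
  let ?A = "\<lambda>i::nat. {e \<in> E. v \<notin> e \<and> f e = i}"
  have fV: "finite V" and EV: "E \<subseteq> pairs V" using G unfolding simple_graph_iff_pairs by auto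
  have W2: "2 \<le> card ?W" using V v fV by simp
  have NW: "?N \<subseteq> ?W" using EV unfolding pairs_def by (auto simp: card_insert_if split: if_splits)
  \<comment> \<open>If \<open>v\<close> has no neighbour, nothing could attach it to the tree of
    colour \<open>0\<close>, which then lives on \<open>V - {v}\<close> like the others.\<close>
  define P where "P i = (if i = 0 \<and> ?N \<noteq> {} then V else ?W)" for i :: nat
  define D where "D i = (if i = 0 \<and> ?N \<noteq> {} then ?A i \<union> {{v, w} |w. w \<in> ?N} else ?A i)" for i
  have DE: "D i \<subseteq> E" for i unfolding D_def by auto
  have DP: "simple_graph (P i, D i)" for i
  proof -
    have "?A i \<subseteq> pairs ?W" using EV unfolding pairs_def by auto
    moreover have "E \<subseteq> pairs V" by (rule EV)
    ultimately show ?thesis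
      unfolding simple_graph_iff_pairs P_def D_def using fV by auto
  qed
  have Pconn: "connected_graph (P i, D i)" if i: "i < k" for i
  proof (cases "i = 0 \<and> ?N \<noteq> {}")
    case True
    then obtain w0 where w0: "w0 \<in> ?N" by blast
    let ?L = "linked {} (D 0)"
    have eq: "equiv UNIV ?L" by (rule equiv_linked) (simp add: sym_def)
    have sL: "(y, x) \<in> ?L" if "(x, y) \<in> ?L" for x y
      using linked_sym[OF _ that] by (simp add: sym_def)
    have Nv: "(v, w) \<in> ?L" if "w \<in> ?N" for w
    proof (rule linked_edge)
      show "{v, w} \<in> D 0" using that unfolding D_def by auto
    qed
    have "linked (?N \<times> ?N) (?A 0) \<subseteq> ?L"
    proof (rule linked_least[OF _ _ eq])
      show "?N \<times> ?N \<subseteq> ?L"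
        by (intro subrelI) (metis linked_trans mem_Sigma_iff sL Nv)
      show "(x, y) \<in> ?L" if "{x, y} \<in> ?A 0" for x y
      proof (rule linked_edge)
        show "{x, y} \<in> D 0" using that unfolding D_def by auto
      qed
    qed
    then have WL: "?W \<times> ?W \<subseteq> ?L" using f[OF i] True by auto
    have "(v, x) \<in> ?L" if "x \<in> V" for x
    proof (cases "x = v")
      case False
      then have "(w0, x) \<in> ?L" using WL w0 NW that by blast
      with Nv[OF w0] show ?thesis by (rule linked_trans)
    qed simp
    then have "V \<times> V \<subseteq> ?L"
      by (intro subrelI) (metis linked_trans mem_Sigma_iff sL)
    then show ?thesis using True v unfolding connected_graph_iff_linked P_def by auto
  next
    case False
    then have "linked (if i = 0 then ?N \<times> ?N else {}) (?A i) = linked {} (D i)"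
      unfolding D_def by auto
    then have "?W \<times> ?W \<subseteq> linked {} (D i)" using f[OF i] by metis
    moreover have "?W \<noteq> {}" using W2 by force
    ultimately show ?thesis using False unfolding connected_graph_iff_linked P_def by auto
  qed
  have "\<exists>A'. A' \<subseteq> D i \<and> is_tree (P i, A')" if "i < k" for i
    using spanning_tree_exists[OF DP Pconn[OF that]] by blast
  then obtain A' where A': "\<And>i. i < k \<Longrightarrow> A' i \<subseteq> D i \<and> is_tree (P i, A' i)" by metis
  let ?T = "\<lambda>i. (P i, A' i)"
  have disj: "A' i \<inter> A' j = {}" if "i < k" "j < k" "i \<noteq> j" for i j
  proof -
    have "D i \<inter> D j = {}" using that(3) unfolding D_def by auto
    then show ?thesis using A' that by blast
  qed
  \<comment> \<open>Nonempty disjoint edge sets make the trees distinct, so the family really has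
    \<open>k\<close> members.\<close>
  have ne: "A' i \<noteq> {}" if "i < k" for i
  proof -
    have t: "simple_graph (?T i)" "connected_graph (?T i)"
      using A'[OF that] unfolding is_tree_def by auto
    have "2 \<le> card (P i)" using W2 V unfolding P_def by simp
    then show ?thesis using connected_graph_card_edges[OF t] by auto
  qed
  have inj: "inj_on ?T {..<k}"
    using disj ne unfolding inj_on_def by (metis Int_absorb lessThan_iff prod.inject)
  have fam: "disjoint_tree_family (V, E) ?W (?T ` {..<k})"
    unfolding disjoint_tree_family_def
  proof
    have "tree_connecting (V, E) ?W (?T i)" if "i < k" for i
    proof -
      have "is_tree (?T i)" "A' i \<subseteq> E" using A'[OF that] DE[of i] by auto
      moreover have "?W \<subseteq> P i" "P i \<subseteq> V" unfolding P_def by auto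
      ultimately show ?thesis
        unfolding tree_connecting_def subgraph_def is_tree_def fst_conv snd_conv by blast
    qed
    then show "\<forall>T\<in>?T ` {..<k}. tree_connecting (V, E) ?W T" by blast
    show "pairwise (internally_disjoint ?W) (?T ` {..<k})"
    proof (rule pairwiseI)
      fix T T' assume "T \<in> ?T ` {..<k}" "T' \<in> ?T ` {..<k}" "T \<noteq> T'"
      then obtain i j where ij: "i < k" "j < k" "T = ?T i" "T' = ?T j" "i \<noteq> j" by auto
      then have "P i \<inter> P j = ?W" unfolding P_def by auto
      then show "internally_disjoint ?W T T'"
        using disj[OF ij(1,2,5)] ij unfolding internally_disjoint_def by simp
    qed
  qed
  have "k = card (?T ` {..<k})" using inj by (simp add: card_image)
  also have "\<dots> \<le> kappa (V, E) ?W" by (rule kappa_geI[OF G fam])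
  also have "\<dots> \<le> kappa_bar (card V - 1) (V, E)"
    using v fV by (intro kappa_bar_geI[OF G]) auto
  finally show ?thesis .
qed

section \<open>Edges crossing a partition\<close>

lemma card_pairs: "finite V \<Longrightarrow> card (pairs V) = card V choose 2"
  unfolding pairs_def by (rule n_subsets)

lemma pairsI: "x \<in> V \<Longrightarrow> y \<in> V \<Longrightarrow> x \<noteq> y \<Longrightarrow> {x, y} \<in> pairs V"
  unfolding pairs_def by simp

lemma crossing_subset: "crossing Q X \<subseteq> X"
  unfolding crossing_def by blast

lemma crossingI: "{x, y} \<in> X \<Longrightarrow> (x, y) \<notin> Q \<Longrightarrow> {x, y} \<in> crossing Q X"
  unfolding crossing_def by blast

lemma quotient_representatives:
  assumes W: "finite W" and Q: "equiv UNIV Q"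
  obtains R where "R \<subseteq> W" "card R = card (W // Q)"
    "\<And>x y. x \<in> R \<Longrightarrow> y \<in> R \<Longrightarrow> (x, y) \<in> Q \<Longrightarrow> x = y" "\<And>w. w \<in> W \<Longrightarrow> \<exists>x\<in>R. (w, x) \<in> Q"
proof -
  let ?g = "\<lambda>w. Q `` {w}"
  obtain R where R: "R \<subseteq> W" "inj_on ?g R" "?g ` W = ?g ` R"
    using subset_image_inj[of "?g ` W" ?g W] by auto
  have same: "?g x = ?g y \<longleftrightarrow> (x, y) \<in> Q" for x y
    using eq_equiv_class_iff[OF Q] by simp
  show ?thesis
  proof
    show "R \<subseteq> W" by (rule R)
    show "card R = card (W // Q)" unfolding quotient_eq_image R(3) using R(2) by (simp add: card_image)
    show "x = y" if "x \<in> R" "y \<in> R" "(x, y) \<in> Q" for x y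
      using inj_onD[OF R(2)] that same by simp
    show "\<exists>x\<in>R. (w, x) \<in> Q" if "w \<in> W" for w
    proof -
      have "?g w \<in> ?g ` R" using R(3) that by (metis imageI)
      then obtain x where "x \<in> R" "?g w = ?g x" by (rule imageE)
      then show ?thesis using same by blast
    qed
  qed
qed

text \<open>Representatives cross pairwise, and a vertex outside \<open>R\<close> crosses to all
  representatives but its own. The third summand keeps what this misses; it is needed when the other
  two are short by one.\<close>

lemma card_crossing_ge:
  assumes W: "finite W" and Q: "equiv UNIV Q" and RW: "R \<subseteq> W"
    and inj: "\<And>x y. x \<in> R \<Longrightarrow> y \<in> R \<Longrightarrow> (x, y) \<in> Q \<Longrightarrow> x = y"
    and rep: "\<And>w. w \<in> W \<Longrightarrow> \<exists>x\<in>R. (w, x) \<in> Q"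
  shows "(card R choose 2) + card (W - R) * (card R - 1) + card (crossing Q (pairs (W - R)))
    \<le> card (crossing Q (pairs W))"
proof -
  have sym: "(y, x) \<in> Q" if "(x, y) \<in> Q" for x y using Q that by (simp add: equiv_def sym_def)
  have trans: "(x, z) \<in> Q" if "(x, y) \<in> Q" "(y, z) \<in> Q" for x y z
    using Q that by (meson equiv_def transD)
  have fR: "finite R" using RW W by (rule finite_subset)
  let ?S = "SIGMA w:W - R. {x \<in> R. (w, x) \<notin> Q}"
  let ?P = "(\<lambda>(w, x). {w, x}) ` ?S"
  let ?C = "crossing Q (pairs (W - R))"
  have fS: "finite ?S" using W fR by auto
  have "card ?P = card ?S"
    by (intro card_image) (auto simp: inj_on_def doubleton_eq_iff)
  also have "\<dots> = (\<Sum>w\<in>W - R. card {x \<in> R. (w, x) \<notin> Q})"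
    using W fR by (intro card_SigmaI) auto
  also have "\<dots> = (\<Sum>w\<in>W - R. card R - 1)"
  proof (intro sum.cong refl)
    fix w assume "w \<in> W - R"
    then obtain x where x: "x \<in> R" "(w, x) \<in> Q" using rep by blast
    have "{y \<in> R. (w, y) \<notin> Q} = R - {x}"
      using x inj sym trans by blast
    then show "card {y \<in> R. (w, y) \<notin> Q} = card R - 1" using x fR by simp
  qed
  finally have P: "card ?P = card (W - R) * (card R - 1)" by simp
  have "card (pairs R) + card ?P + card ?C = card (pairs R \<union> ?P \<union> ?C)"
  proof -
    have "pairs R \<inter> ?P = {}" "(pairs R \<union> ?P) \<inter> ?C = {}"
      unfolding pairs_def crossing_def by auto
    moreover have "finite (pairs R)" "finite ?P" "finite ?C"
      using fR fS W finite_pairs crossing_subset finite_subset by (blast, blast, metis finite_Diff)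
    ultimately show ?thesis by (simp add: card_Un_disjoint)
  qed
  also have "\<dots> \<le> card (crossing Q (pairs W))"
  proof (rule card_mono)
    show "finite (crossing Q (pairs W))"
      using W finite_pairs crossing_subset finite_subset by metis
    have "e \<in> crossing Q (pairs W)" if "e \<in> pairs R" for e
    proof -
      from that obtain x y where e: "e = {x, y}" "x \<noteq> y" "x \<in> R" "y \<in> R" by (elim pairsE)
      then show ?thesis unfolding e(1) using inj RW by (intro crossingI pairsI) auto
    qed
    moreover have "?P \<subseteq> crossing Q (pairs W)"
      using RW by (auto intro!: crossingI pairsI)
    moreover have "?C \<subseteq> crossing Q (pairs W)"
      unfolding crossing_def pairs_def by blast
    ultimately show "pairs R \<union> ?P \<union> ?C \<subseteq> crossing Q (pairs W)" by blast
  qed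
  finally show ?thesis using P fR by (simp add: card_pairs)
qed

lemma card_crossing_ge_product:
  assumes W: "finite W" and A: "A \<subseteq> W" and B: "B \<subseteq> W" and AB: "A \<inter> B = {}"
    and sep: "\<And>a b. a \<in> A \<Longrightarrow> b \<in> B \<Longrightarrow> (a, b) \<notin> Q"
  shows "card A * card B \<le> card (crossing Q (pairs W))"
proof -
  have "card A * card B = card ((\<lambda>(a, b). {a, b}) ` (A \<times> B))"
    using AB by (subst card_image) (auto simp: inj_on_def doubleton_eq_iff card_cartesian_product)
  also have "\<dots> \<le> card (crossing Q (pairs W))"
  proof (rule card_mono)
    show "finite (crossing Q (pairs W))"
      using W finite_pairs crossing_subset finite_subset by metis
    show "(\<lambda>(a, b). {a, b}) ` (A \<times> B) \<subseteq> crossing Q (pairs W)"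
      using A B AB sep by (auto intro!: crossingI pairsI)
  qed
  finally show ?thesis .
qed

section \<open>Packing trees in dense graphs\<close>

text \<open>\<open>m\<close> is the size of the sets to be connected. Edges are counted through the
  complement, so the minimum degree of \<open>v\<close> appears as a maximum degree there.\<close>

locale dense_graph =
  fixes V :: "'a set" and E :: "'a set set" and v :: 'a and m :: nat
  assumes finV: "finite V" and cardV: "card V = Suc m" and EV: "E \<subseteq> pairs V" and vV: "v \<in> V"
    and max_deg: "\<And>x. x \<in> V \<Longrightarrow> card {e \<in> pairs V - E. x \<in> e} \<le> card {e \<in> pairs V - E. v \<in> e}"
begin

definition H where "H = pairs V - E"

definition W where "W = V - {v}"

definition EW where "EW = {e \<in> E. v \<notin> e}"

definition HW where "HW = {e \<in> H. v \<notin> e}"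

definition N where "N = {w. {v, w} \<in> E}"

definition deg where "deg x = card {e \<in> H. x \<in> e}"

text \<open>The vertex \<open>v\<close> joins all classes that contain one of its neighbours.\<close>

definition merged where "merged Q = card (W // (Q \<union> N \<times> N)\<^sup>*)"

lemma finW: "finite W" and cardW: "card W = m"
  using finV cardV vV unfolding W_def by auto

lemma finH: "finite H"
  using finite_pairs[OF finV] unfolding H_def by simp

lemma NW: "N \<subseteq> W"
  using EV unfolding N_def W_def pairs_def by (auto simp: card_insert_if split: if_splits)

lemma pairs_W: "pairs W = EW \<union> HW"
  using EV unfolding pairs_def W_def EW_def HW_def H_def by auto

lemma deg_le: "x \<in> V \<Longrightarrow> deg x \<le> deg v"
  using max_deg unfolding deg_def H_def by simp

lemma card_HW: "card HW + deg v = card H"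
proof -
  have "H = HW \<union> {e \<in> H. v \<in> e}" unfolding HW_def by auto
  then have "card H = card (HW \<union> {e \<in> H. v \<in> e})" by simp
  also have "\<dots> = card HW + card {e \<in> H. v \<in> e}"
    using finH unfolding HW_def by (intro card_Un_disjoint) auto
  finally show ?thesis unfolding deg_def by simp
qed

lemma handshake: "(\<Sum>x\<in>V. deg x) = 2 * card H"
  unfolding deg_def
proof (rule sum_multicount[OF finV finH])
  have "{x \<in> V. x \<in> e} = e" if "e \<in> H" for e using that unfolding H_def pairs_def by auto
  then show "\<forall>e\<in>H. card {x \<in> V. x \<in> e} = 2" unfolding H_def pairs_def by auto
qed

lemma card_H_le: "2 * card H \<le> Suc m * deg v"
proof -
  have "(\<Sum>x\<in>V. deg x) \<le> (\<Sum>x\<in>V. deg v)" using deg_le by (intro sum_mono)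
  then show ?thesis unfolding handshake by (simp add: cardV)
qed

lemma card_W_minus_N: "card (W - N) = deg v"
proof -
  have "{e \<in> H. v \<in> e} = (\<lambda>w. {v, w}) ` (W - N)"
  proof (intro set_eqI iffI)
    fix e assume "e \<in> {e \<in> H. v \<in> e}"
    then have e: "e \<in> pairs V" "e \<notin> E" "v \<in> e" unfolding H_def by auto
    then obtain x y where "e = {x, y}" "x \<noteq> y" "x \<in> V" "y \<in> V" by (elim pairsE)
    then obtain w where "e = {v, w}" "w \<in> V" "w \<noteq> v" using e(3) by (auto simp: insert_commute)
    then show "e \<in> (\<lambda>w. {v, w}) ` (W - N)" using e(2) unfolding W_def N_def by auto
  next
    fix e assume "e \<in> (\<lambda>w. {v, w}) ` (W - N)"
    then show "e \<in> {e \<in> H. v \<in> e}"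
      using vV unfolding H_def W_def N_def by (auto intro!: pairsI)
  qed
  moreover have "inj_on (\<lambda>w. {v, w}) (W - N)" by (auto simp: inj_on_def doubleton_eq_iff)
  ultimately show ?thesis unfolding deg_def by (simp add: card_image)
qed

text \<open>\<open>X\<close> allows an application to charge only those missing edges that can
  actually cross.\<close>

lemma card_crossing_EW:
  assumes "crossing Q HW \<subseteq> X" "finite X"
  shows "card (crossing Q (pairs W)) \<le> card (crossing Q EW) + card X"
proof -
  have "crossing Q (pairs W) \<subseteq> crossing Q EW \<union> X"
    using assms(1) unfolding pairs_W crossing_def by blast
  moreover have "finite (crossing Q EW)"
    using crossing_subset[of Q EW] finite_pairs[OF finW] pairs_W by (metis finite_Un finite_subset)
  ultimately have "card (crossing Q (pairs W)) \<le> card (crossing Q EW \<union> X)"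
    using assms(2) by (intro card_mono) auto
  then show ?thesis using card_Un_le order_trans by blast
qed

lemma card_crossing_EW_ge: "card (crossing Q (pairs W)) + deg v \<le> card (crossing Q EW) + card H"
proof -
  have "card (crossing Q (pairs W)) \<le> card (crossing Q EW) + card HW"
    using finH by (intro card_crossing_EW crossing_subset) (simp add: HW_def)
  then show ?thesis using card_HW by linarith
qed

text \<open>Colour \<open>0\<close> is the tree through \<open>v\<close>; the other \<open>d\<close>
  colours have an empty base relation, and closing the equivalence \<open>Q\<close> adds
  nothing.\<close>

lemma sum_components:
  assumes Q: "equiv UNIV Q"
  shows "(\<Sum>i<Suc d. card (W // (Q \<union> (if i = 0 then N \<times> N else {}))\<^sup>*)) = merged Q + d * card (W // Q)"
proof -
  have "Q\<^sup>* = Q"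
    using linked_least[of Q Q "{}"] Q unfolding linked_def by auto
  then show ?thesis
    unfolding merged_def by (subst sum.lessThan_Suc_shift) simp
qed

lemma equiv_merged: "equiv UNIV Q \<Longrightarrow> equiv UNIV ((Q \<union> N \<times> N)\<^sup>*)"
  by (intro equivI refl_rtrancl sym_rtrancl trans_rtrancl) (auto simp: sym_Un equiv_def sym_def)

text \<open>All neighbours of \<open>v\<close> share one class, and only the \<open>deg v\<close>
  other vertices of \<open>W\<close> can contribute further ones.\<close>

lemma merged_le:
  assumes Q: "equiv UNIV Q"
  shows "merged Q \<le> card (W // Q)" "merged Q \<le> Suc (deg v)"
proof -
  let ?R = "(Q \<union> N \<times> N)\<^sup>*"
  have R: "equiv UNIV ?R" using equiv_merged[OF Q] .
  show "merged Q \<le> card (W // Q)"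
    unfolding merged_def by (intro card_quotient_mono finW Q R) auto
  have fin: "finite (W - N)" using finW by simp
  show "merged Q \<le> Suc (deg v)"
  proof (cases "N = {}")
    case True
    then have "merged Q \<le> card (W - N)"
      unfolding merged_def quotient_eq_image using card_image_le[OF finW] by simp
    then show ?thesis using card_W_minus_N by simp
  next
    case False
    then obtain n where n: "n \<in> N" by blast
    have "W // ?R \<subseteq> insert (?R `` {n}) ((\<lambda>w. ?R `` {w}) ` (W - N))"
    proof
      fix X assume "X \<in> W // ?R"
      then obtain w where w: "w \<in> W" "X = ?R `` {w}" unfolding quotient_eq_image by blast
      have "?R `` {w} = ?R `` {n}" if "w \<in> N"
        using n that by (intro equiv_class_eq[OF R]) auto
      then show "X \<in> insert (?R `` {n}) ((\<lambda>w. ?R `` {w}) ` (W - N))" using w by auto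
    qed
    then have "merged Q \<le> card (insert (?R `` {n}) ((\<lambda>w. ?R `` {w}) ` (W - N)))"
      unfolding merged_def using fin by (intro card_mono) auto
    also have "\<dots> \<le> Suc (card ((\<lambda>w. ?R `` {w}) ` (W - N)))"
      using fin by (simp add: card_insert_if)
    also have "\<dots> \<le> Suc (deg v)" using card_image_le[OF fin] card_W_minus_N by (metis Suc_le_mono)
    finally show ?thesis .
  qed
qed

lemma kappa_bar_ge:
  assumes m: "2 \<le> m"
    and crit: "\<And>Q. equiv UNIV Q \<Longrightarrow> merged Q + d * card (W // Q) \<le> card (crossing Q EW) + Suc d"
  shows "Suc d \<le> kappa_bar m (V, E)"
proof -
  have ne: "W \<noteq> {}" using cardW m by auto
  have sub: "EW \<subseteq> pairs W" using pairs_W by auto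
  obtain f where f: "\<And>i. i < Suc d \<Longrightarrow>
      W \<times> W \<subseteq> linked (if i = 0 then N \<times> N else {}) {e \<in> EW. f e = i}"
  proof (rule connected_packing[OF finW ne sub, of "\<lambda>i. if i = 0 then N \<times> N else {}" "Suc d"])
    show "sym (if i = 0 then N \<times> N else {})" for i :: nat by (simp add: sym_def)
    show "(\<Sum>i<Suc d. card (W // (Q \<union> (if i = 0 then N \<times> N else {}))\<^sup>*))
        \<le> card (crossing Q EW) + Suc d" if "equiv UNIV Q" for Q
      unfolding sum_components[OF that] by (rule crit[OF that])
  qed auto
  have "Suc d \<le> kappa_bar (card V - 1) (V, E)"
  proof (rule kappa_ge_packing[where f = f])
    show "simple_graph (V, E)" using finV EV unfolding simple_graph_iff_pairs by simp
    show "3 \<le> card V" using cardV m by simp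
    fix i assume "i < Suc d"
    from f[OF this] show "(V - {v}) \<times> (V - {v}) \<subseteq>
      linked (if i = 0 then {w. {v, w} \<in> E} \<times> {w. {v, w} \<in> E} else {}) {e \<in> E. v \<notin> e \<and> f e = i}"
      unfolding N_def W_def EW_def by (simp add: conj_assoc)
  qed (rule vV)
  then show ?thesis using cardV by simp
qed

section \<open>The partition inequality, by the number of classes\<close>

text \<open>The \<open>deg v\<close> missing edges at \<open>v\<close> lie outside \<open>W\<close>
  and pay for \<open>merged Q <= Suc (deg v)\<close>. Representatives yield
  \<open>(Suc r choose 2) + (m - Suc r) * r\<close> crossing pairs, twice which is
  \<open>r * (2 * m - r - 1)\<close>.\<close>

lemma criterion_generic:
  assumes Q: "equiv UNIV Q" and p: "card (W // Q) = Suc r"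
    and h: "2 * int (card H) \<le> int r * (2 * int m - int r - 1 - 2 * int d)"
  shows "merged Q + d * card (W // Q) \<le> card (crossing Q EW) + Suc d"
proof -
  obtain R where R: "R \<subseteq> W" "card R = Suc r"
    "\<And>x y. x \<in> R \<Longrightarrow> y \<in> R \<Longrightarrow> (x, y) \<in> Q \<Longrightarrow> x = y" "\<And>w. w \<in> W \<Longrightarrow> \<exists>x\<in>R. (w, x) \<in> Q"
    using quotient_representatives[OF finW Q] p by metis
  have rm: "Suc r \<le> m" using card_mono[OF finW R(1)] R(2) cardW by simp
  have WR: "card (W - R) = m - Suc r"
    using R(1,2) finW cardW by (simp add: card_Diff_subset finite_subset)
  have "(Suc r choose 2) + (m - Suc r) * r \<le> card (crossing Q (pairs W))"
    using card_crossing_ge[OF finW Q R(1,3,4)] WR R(2) by simp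
  then have "2 * (Suc r choose 2) + 2 * ((m - Suc r) * r) + 2 * deg v \<le> 2 * card (crossing Q EW) + 2 * card H"
    using card_crossing_EW_ge[of Q] by linarith
  moreover have "2 * (Suc r choose 2) = Suc r * r" by (simp add: choose_two)
  ultimately have "Suc r * r + 2 * ((m - Suc r) * r) + 2 * deg v \<le> 2 * card (crossing Q EW) + 2 * card H"
    by linarith
  \<comment> \<open>Integers are used from here on, as the differences would be truncated on natural
    numbers.\<close>
  then have "int (Suc r * r + 2 * ((m - Suc r) * r) + 2 * deg v)
      \<le> int (2 * card (crossing Q EW) + 2 * card H)" by (simp only: of_nat_le_iff)
  then have "int r * (2 * int m - int r - 1) + 2 * int (deg v)
      \<le> 2 * int (card (crossing Q EW)) + 2 * int (card H)"
  proof -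
    obtain t where "m = Suc r + t" using le_Suc_ex[OF rm] by (elim exE)
    then show ?thesis
      using \<open>int (Suc r * r + 2 * ((m - Suc r) * r) + 2 * deg v) \<le> _\<close> by (simp add: algebra_simps)
  qed
  then have "2 * (int r * int d) + 2 * int (deg v) \<le> 2 * int (card (crossing Q EW))"
    using h by (simp add: algebra_simps)
  then have "r * d + deg v \<le> card (crossing Q EW)"
    by (metis (mono_tags, opaque_lifting) distrib_left_numeral mult_le_cancel_left_pos of_nat_add of_nat_le_iff of_nat_mult zero_less_numeral)
  then show ?thesis using merged_le(2)[OF Q] p by (simp add: algebra_simps)
qed

text \<open>Two vertices of large degree in the complement would together use too many edges.\<close>

lemma deg_le_half:
  assumes h: "card H + 2 * d + 2 \<le> 2 * m" and x: "x \<in> W"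
  shows "deg x + d + 1 \<le> m"
proof -
  have xV: "x \<in> V" "x \<noteq> v" using x unfolding W_def by auto
  have "deg x + deg v = card ({e \<in> H. x \<in> e} \<union> {e \<in> H. v \<in> e}) + card ({e \<in> H. x \<in> e} \<inter> {e \<in> H. v \<in> e})"
    unfolding deg_def using finH by (intro card_Un_Int) auto
  moreover have "card ({e \<in> H. x \<in> e} \<union> {e \<in> H. v \<in> e}) \<le> card H"
    using finH by (intro card_mono) auto
  moreover have "card ({e \<in> H. x \<in> e} \<inter> {e \<in> H. v \<in> e}) \<le> 1"
  proof -
    have "{e \<in> H. x \<in> e} \<inter> {e \<in> H. v \<in> e} \<subseteq> {{x, v}}"
      using xV(2) unfolding H_def pairs_def card_2_iff by auto
    then show ?thesis using card_mono[of "{{x, v}}"] by simp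
  qed
  ultimately show ?thesis using deg_le[OF xV(1)] h by linarith
qed

lemma card_HW_at:
  assumes "x \<in> W"
  shows "deg x = card {e \<in> HW. x \<in> e} + (if x \<in> N then 0 else 1)"
proof -
  have "x \<noteq> v" "x \<in> V" using assms unfolding W_def by auto
  have "e = {v, x}" if "e \<in> H" "x \<in> e" "v \<in> e" for e
    using that \<open>x \<noteq> v\<close> unfolding H_def pairs_def card_2_iff by auto
  moreover have "{v, x} \<in> H \<longleftrightarrow> x \<notin> N"
    using \<open>x \<in> V\<close> \<open>x \<noteq> v\<close> vV unfolding H_def N_def by (auto intro: pairsI)
  ultimately have "{e \<in> H. x \<in> e} = {e \<in> HW. x \<in> e} \<union> (if x \<in> N then {} else {{v, x}})"
    unfolding HW_def by auto
  then have "deg x = card ({e \<in> HW. x \<in> e} \<union> (if x \<in> N then {} else {{v, x}}))"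
    unfolding deg_def by simp
  also have "\<dots> = card {e \<in> HW. x \<in> e} + (if x \<in> N then 0 else 1)"
    using finH unfolding HW_def by (auto simp: card_insert_if)
  finally show ?thesis .
qed

text \<open>Applied backwards: if there are only two classes, any two vertices outside the class of
  \<open>x\<close> are equivalent.\<close>

lemma three_classes:
  assumes Q: "equiv UNIV Q" and W: "x \<in> W" "y \<in> W" "z \<in> W"
    and Q': "(x, y) \<notin> Q" "(x, z) \<notin> Q" "(y, z) \<notin> Q"
  shows "3 \<le> card (W // Q)"
proof -
  have "Q `` {x} \<noteq> Q `` {y}" "Q `` {x} \<noteq> Q `` {z}" "Q `` {y} \<noteq> Q `` {z}"
    using Q' eq_equiv_class_iff[OF Q] by simp_all
  then have "card {Q `` {x}, Q `` {y}, Q `` {z}} = 3" by simp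
  moreover have "card {Q `` {x}, Q `` {y}, Q `` {z}} \<le> card (W // Q)"
    using W finW by (intro card_mono) (auto simp: quotient_eq_image)
  ultimately show ?thesis by simp
qed

text \<open>Only missing edges at \<open>x\<close> can cross, and \<open>deg x <= m - d - 1\<close>.
  This settles \<open>merged Q = 1\<close>, as happens when \<open>x\<close> and some other vertex
  are neighbours of \<open>v\<close>. For \<open>merged Q = 2\<close> one more unit is needed; if
  \<open>x\<close> is not a neighbour of \<open>v\<close>, it is the missing edge
  \<open>{v, x}\<close>, which does not lie in \<open>W\<close>.\<close>

lemma criterion_two_singleton:
  assumes Q: "equiv UNIV Q" and p: "card (W // Q) = 2"
    and d: "1 \<le> d" and h: "card H + 2 * d + 2 \<le> 2 * m" and m: "2 * d + 2 \<le> m"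
    and x: "x \<in> W" and single: "\<And>w. w \<in> W \<Longrightarrow> (x, w) \<in> Q \<Longrightarrow> w = x"
  shows "merged Q + d \<le> Suc (card (crossing Q EW))"
proof -
  have "card {x} * card (W - {x}) \<le> card (crossing Q (pairs W))"
    using x single by (intro card_crossing_ge_product finW) auto
  moreover have "card (crossing Q (pairs W)) \<le> card (crossing Q EW) + card {e \<in> HW. x \<in> e}"
  proof -
    have W2: "(y, z) \<in> Q" if yz: "y \<in> W" "z \<in> W" "y \<noteq> x" "z \<noteq> x" for y z
      using three_classes[OF Q x yz(1,2)] single yz p by fastforce
    have "crossing Q HW \<subseteq> {e \<in> HW. x \<in> e}"
    proof
      fix e assume e: "e \<in> crossing Q HW"
      then obtain y z where yz: "e = {y, z}" "(y, z) \<notin> Q" "e \<in> HW" unfolding crossing_def by blast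
      then have "y \<in> W" "z \<in> W" unfolding HW_def H_def W_def pairs_def by auto
      then show "e \<in> {e \<in> HW. x \<in> e}" using W2 yz by blast
    qed
    then show ?thesis using finH by (intro card_crossing_EW) (auto simp: HW_def)
  qed
  ultimately have X: "m \<le> Suc (card (crossing Q EW) + card {e \<in> HW. x \<in> e})"
    using finW cardW x by simp
  have dx: "deg x + d + 1 \<le> m" using deg_le_half[OF h x] .
  have q2: "merged Q \<le> 2" using merged_le(1)[OF Q] p by simp
  show ?thesis
  proof (cases "x \<in> N")
    case False
    then show ?thesis using card_HW_at[OF x] X dx q2 by simp
  next
    case True
    show ?thesis
    proof (cases "N = {x}")
      case True
      \<comment> \<open>Here \<open>v\<close> absorbs \<open>m - 1\<close> missing edges, and at
        most \<open>m - 1 - 2 * d\<close> remain inside \<open>W\<close>.\<close>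
      then have "deg v = m - 1" using card_W_minus_N finW cardW x by simp
      moreover have "card {e \<in> HW. x \<in> e} \<le> card HW"
        using finH by (intro card_mono) (auto simp: HW_def)
      ultimately show ?thesis using X card_HW h d m q2 by linarith
    next
      case False
      then obtain w where w: "w \<in> N" "w \<noteq> x" using \<open>x \<in> N\<close> by blast
      let ?R = "(Q \<union> N \<times> N)\<^sup>*"
      have R: "equiv UNIV ?R" using equiv_merged[OF Q] .
      have "(x, y) \<in> ?R" if y: "y \<in> W" for y
      proof (cases "y = x")
        case False
        have wW: "w \<in> W" using w NW by blast
        have "(w, y) \<in> Q"
          using three_classes[OF Q x wW y] single[OF wW] single[OF y] w(2) False p by fastforce
        then have "(w, y) \<in> ?R" by (simp add: r_into_rtrancl)
        moreover have "(x, w) \<in> ?R" using \<open>x \<in> N\<close> w by (intro r_into_rtrancl) simp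
        ultimately show ?thesis by (rule rtrancl_trans[rotated])
      qed simp
      then have "W // ?R \<subseteq> {?R `` {x}}"
        using equiv_class_eq[OF R] unfolding quotient_eq_image by auto
      then have "merged Q \<le> 1" unfolding merged_def using card_mono[of "{?R `` {x}}"] by simp
      then show ?thesis using card_HW_at[OF x] True X dx by simp
    qed
  qed
qed

lemma criterion_two:
  assumes Q: "equiv UNIV Q" and p: "card (W // Q) = 2"
    and d: "1 \<le> d" and h: "card H + 2 * d + 2 \<le> 2 * m" and m: "2 * d + 2 \<le> m" "11 \<le> m"
  shows "merged Q + d * card (W // Q) \<le> card (crossing Q EW) + Suc d"
proof (cases "\<exists>x\<in>W. \<forall>w\<in>W. (x, w) \<in> Q \<longrightarrow> w = x")
  case True
  then obtain x where "x \<in> W" "\<And>w. w \<in> W \<Longrightarrow> (x, w) \<in> Q \<Longrightarrow> w = x" by blast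
  from criterion_two_singleton[OF Q p d h m(1) this] show ?thesis using p by simp
next
  case False
  have sym: "(y, x) \<in> Q" if "(x, y) \<in> Q" for x y using Q that by (simp add: equiv_def sym_def)
  have trans: "(x, z) \<in> Q" if "(x, y) \<in> Q" "(y, z) \<in> Q" for x y z
    using Q that by (meson equiv_def transD)
  obtain R where R: "R \<subseteq> W" "card R = 2"
    "\<And>x y. x \<in> R \<Longrightarrow> y \<in> R \<Longrightarrow> (x, y) \<in> Q \<Longrightarrow> x = y" "\<And>w. w \<in> W \<Longrightarrow> \<exists>x\<in>R. (w, x) \<in> Q"
    using quotient_representatives[OF finW Q] p by metis
  obtain a b where ab: "R = {a, b}" "a \<noteq> b" using R(2) by (auto simp: card_2_iff)
  let ?A = "{w \<in> W. (w, a) \<in> Q}" and ?B = "{w \<in> W. (w, b) \<in> Q}"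
  have nab: "(a, b) \<notin> Q" using R(3)[of a b] ab by auto
  then have disj: "?A \<inter> ?B = {}" using sym trans by blast
  have "W = ?A \<union> ?B" using R(4) ab(1) by blast
  then have "card W = card (?A \<union> ?B)" by simp
  then have sum: "card ?A + card ?B = m"
    using card_Un_disjoint[of ?A ?B] disj finW cardW by simp
  have two: "2 \<le> card {w \<in> W. (w, x) \<in> Q}" if x: "x \<in> W" for x
  proof -
    obtain w where w: "w \<in> W" "(x, w) \<in> Q" "w \<noteq> x" using False x by blast
    have "(x, x) \<in> Q" using Q by (simp add: equiv_def refl_on_def)
    then have "{x, w} \<subseteq> {w \<in> W. (w, x) \<in> Q}" using w x sym by auto
    then have "card {x, w} \<le> card {w \<in> W. (w, x) \<in> Q}" using finW by (intro card_mono) auto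
    then show ?thesis using w(3) by simp
  qed
  have A: "2 \<le> card ?A" and B: "2 \<le> card ?B" using two R(1) ab(1) by auto
  have "card ?A * card ?B \<le> card (crossing Q (pairs W))"
  proof (rule card_crossing_ge_product[OF finW _ _ disj])
    fix s t assume "s \<in> ?A" "t \<in> ?B"
    then have "(a, s) \<in> Q" "(t, b) \<in> Q" using sym by simp_all
    then show "(s, t) \<notin> Q" using nab trans by metis
  qed simp_all
  moreover obtain s where "card ?A = 2 + s" using le_Suc_ex[OF A] by (elim exE)
  moreover obtain t where "card ?B = 2 + t" using le_Suc_ex[OF B] by (elim exE)
  \<comment> \<open>Both classes have at least two vertices, and
    \<open>(2 + s) * (2 + t) >= 4 + 2 * s + 2 * t = 2 * m - 4\<close>.\<close>
  ultimately have X: "2 * m \<le> card (crossing Q (pairs W)) + 4"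
    using sum[symmetric] by (simp add: algebra_simps)
  note X = X card_crossing_EW_ge[of Q]
  have q: "merged Q \<le> 2" "merged Q \<le> Suc (deg v)" using merged_le[OF Q] p by auto
  have "merged Q + d \<le> Suc (card (crossing Q EW))"
  \<comment> \<open>In the exceptional case the count can be short by one, but then the complement
    has maximum degree at most 1 and at most \<open>(m + 1) / 2\<close> edges.\<close>
  proof (cases "d = 1 \<and> deg v \<le> 1")
    case True
    then have "Suc m * deg v \<le> Suc m" using mult_le_mono2[of "deg v" 1 "Suc m"] by simp
    then have "2 * card H \<le> Suc m" using card_H_le by linarith
    then show ?thesis using X q m True by linarith
  next
    case False
    then show ?thesis using X q d h by linarith
  qed
  then show ?thesis using p by simp
qed

text \<open>Pigeonhole, meant for the property of a representative that its class has another
  vertex.\<close>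

lemma card_3_two_alikeE:
  fixes P :: "'b \<Rightarrow> bool"
  assumes "card R = 3"
  obtains x y z where "R = {x, y, z}" "x \<noteq> y" "x \<noteq> z" "y \<noteq> z" "P x = P y"
proof -
  obtain a b c where R: "R = {a, b, c}" "a \<noteq> b" "a \<noteq> c" "b \<noteq> c"
    using assms by (auto simp: card_3_iff)
  consider "P a = P b" | "P a = P c" | "P b = P c" by blast
  then show ?thesis
  proof cases
    case 1
    show ?thesis by (rule that[OF R 1])
  next
    case 2
    have "R = {a, c, b}" using R(1) by auto
    then show ?thesis using that[of a c b] R(2-4) 2 by auto
  next
    case 3
    have "R = {b, c, a}" using R(1) by auto
    then show ?thesis using that[of b c a] R(2-4) 3 by auto
  qed
qed

text \<open>The general count is short by one. If \<open>deg v >= 3\<close>, the bound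
  \<open>merged Q <= 3\<close> makes up for it. Otherwise two of the classes are alike: if both have
  a vertex outside \<open>R\<close>, these two vertices form an additional crossing pair; if both
  are singletons, few missing edges can cross.\<close>

lemma criterion_three:
  assumes Q: "equiv UNIV Q" and p: "card (W // Q) = 3"
    and h: "card H + 2 * d + 2 \<le> 2 * m" and m: "2 * d + 3 \<le> m" "11 \<le> m"
  shows "merged Q + d * card (W // Q) \<le> card (crossing Q EW) + Suc d"
proof -
  have sym: "(y, x) \<in> Q" if "(x, y) \<in> Q" for x y using Q that by (simp add: equiv_def sym_def)
  have trans: "(x, z) \<in> Q" if "(x, y) \<in> Q" "(y, z) \<in> Q" for x y z
    using Q that by (meson equiv_def transD)
  obtain R where R: "R \<subseteq> W" "card R = 3"
    "\<And>x y. x \<in> R \<Longrightarrow> y \<in> R \<Longrightarrow> (x, y) \<in> Q \<Longrightarrow> x = y" "\<And>w. w \<in> W \<Longrightarrow> \<exists>x\<in>R. (w, x) \<in> Q"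
    using quotient_representatives[OF finW Q] p by metis
  have fR: "finite R" using R(1) finW by (rule finite_subset)
  let ?X = "card (crossing Q EW)"
  have WR: "card (W - R) = m - 3"
    using R(1,2) fR cardW by (simp add: card_Diff_subset)
  have "(3 choose 2) = (3::nat)" by (simp add: choose_two)
  then have K: "3 + 2 * (m - 3) + card (crossing Q (pairs (W - R))) \<le> card (crossing Q (pairs W))"
    using card_crossing_ge[OF finW Q R(1,3,4)] WR R(2) by simp
  note X = card_crossing_EW_ge[of Q]
  have q: "merged Q \<le> 3" "merged Q \<le> Suc (deg v)" using merged_le[OF Q] p by auto
  have "merged Q + 2 * d \<le> Suc ?X"
  proof (cases "3 \<le> deg v")
    case True
    then show ?thesis using K X q h m by linarith
  next
    case deg: False
    let ?P = "\<lambda>x. \<exists>w\<in>W - R. (x, w) \<in> Q"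
    obtain x y z where xyz: "R = {x, y, z}" "x \<noteq> y" "x \<noteq> z" "y \<noteq> z" "?P x = ?P y"
      by (rule card_3_two_alikeE[OF R(2)])
    have nxy: "(x, y) \<notin> Q" using R(3)[of x y] xyz(1,2) by auto
    show ?thesis
    proof (cases "?P x")
      case True
      then obtain x' y' where x': "x' \<in> W - R" "(x, x') \<in> Q" and y': "y' \<in> W - R" "(y, y') \<in> Q"
        using xyz(5) by blast
      have n: "(x', y') \<notin> Q" using nxy x' y' sym trans by blast
      then have "x' \<noteq> y'" using Q by (auto simp: equiv_def refl_on_def)
      then have "{x', y'} \<in> crossing Q (pairs (W - R))"
        using x' y' n by (intro crossingI pairsI)
      moreover have "finite (crossing Q (pairs (W - R)))"
        using finite_subset[OF crossing_subset finite_pairs] finW by blast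
      ultimately have "1 \<le> card (crossing Q (pairs (W - R)))"
        by (metis One_nat_def Suc_leI card_gt_0_iff empty_iff)
      then show ?thesis using K X q h m by linarith
    next
      case False
      \<comment> \<open>Everything except \<open>x\<close> and \<open>y\<close> forms the class of
        \<open>z\<close>. So the crossing missing edges meet \<open>x\<close> or \<open>y\<close>,
        and there are at most four, as degrees in the complement are at most 2.\<close>
      have rz: "(w, z) \<in> Q" if w: "w \<in> W" "w \<noteq> x" "w \<noteq> y" for w
      proof (cases "w \<in> R")
        case True
        then show ?thesis using w xyz(1) Q by (auto simp: equiv_def refl_on_def)
      next
        case wR: False
        obtain r where r: "r \<in> R" "(w, r) \<in> Q" using R(4) w(1) by blast
        then have "?P r" using w(1) wR sym by blast
        then have "r \<noteq> x" "r \<noteq> y" using False xyz(5) by auto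
        then show ?thesis using r xyz(1) by blast
      qed
      have sub: "crossing Q HW \<subseteq> {e \<in> H. x \<in> e} \<union> {e \<in> H. y \<in> e}"
      proof
        fix e assume "e \<in> crossing Q HW"
        then obtain a b where e: "e = {a, b}" "(a, b) \<notin> Q" "e \<in> HW" unfolding crossing_def by blast
        then have "a \<in> W" "b \<in> W" "e \<in> H" unfolding HW_def H_def W_def pairs_def by auto
        moreover have "\<not> ((a, z) \<in> Q \<and> (b, z) \<in> Q)" using e(2) sym trans by blast
        ultimately show "e \<in> {e \<in> H. x \<in> e} \<union> {e \<in> H. y \<in> e}" using rz e(1) by blast
      qed
      have "card ({e \<in> H. x \<in> e} \<union> {e \<in> H. y \<in> e}) \<le> deg x + deg y"
        unfolding deg_def by (rule card_Un_le)
      moreover have "card (crossing Q (pairs W)) \<le> ?X + card ({e \<in> H. x \<in> e} \<union> {e \<in> H. y \<in> e})"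
        using finH by (intro card_crossing_EW sub) simp
      moreover have "deg x \<le> deg v" "deg y \<le> deg v"
        using xyz(1) R(1) deg_le unfolding W_def by auto
      ultimately show ?thesis using K deg q m by linarith
    qed
  qed
  then show ?thesis using p by simp
qed

section \<open>How many missing edges still leave \<open>Suc d\<close> trees\<close>

lemma kappa_bar_ge_sparse_complement:
  assumes d: "1 \<le> d" and h: "card H + 2 * d + 2 \<le> 2 * m" and m: "2 * d + 3 \<le> m" "11 \<le> m"
  shows "Suc d \<le> kappa_bar m (V, E)"
proof (rule kappa_bar_ge)
  fix Q :: "('a \<times> 'a) set" assume Q: "equiv UNIV Q"
  have pm: "card (W // Q) \<le> m"
    unfolding quotient_eq_image using card_image_le[OF finW] cardW by metis
  have "card (W // Q) \<noteq> 0"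
    using finW cardW m by (auto simp: quotient_eq_image)
  then obtain r where r: "card (W // Q) = Suc r" using not0_implies_Suc by blast
  consider "r = 0" | "r = 1" | "r = 2" | "3 \<le> r" by linarith
  then show "merged Q + d * card (W // Q) \<le> card (crossing Q EW) + Suc d"
  proof cases
    case 1
    then show ?thesis using merged_le(1)[OF Q] r by simp
  next
    case 2
    then show ?thesis using criterion_two[OF Q _ d h _ m(2)] r m by simp
  next
    case 3
    then show ?thesis using criterion_three[OF Q _ h m] r by simp
  next
    case 4
    \<comment> \<open>In terms of \<open>a\<close> the general bound is
      \<open>r * (2 * a + 1 - r)\<close>, equal at \<open>r = 3\<close> and
      \<open>r = 2 * a - 2\<close>. The hypothesis \<open>2 * d + 3 <= m\<close> puts
      \<open>m - 1\<close>, the largest \<open>r\<close>, below the latter, and concavity does the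
      rest.\<close>
    define a where "a = int m - int d - 1"
    have "int r + 1 \<le> int m" "2 * int d + 3 \<le> int m" "11 \<le> int m"
      using pm r m by simp_all
    then have a: "3 \<le> a" "int r \<le> 2 * a - 2" unfolding a_def by simp_all
    have "0 \<le> (int r - 3) * (2 * a - 2 - int r)" using 4 a by (intro mult_nonneg_nonneg) auto
    then have "3 * (2 * a - 2) \<le> int r * (2 * a + 1 - int r)" by (simp add: algebra_simps)
    moreover have "2 * int (card H) \<le> 3 * (2 * a - 2)" using h a(1) unfolding a_def by simp
    ultimately have "2 * int (card H) \<le> int r * (2 * a + 1 - int r)" by (rule order_trans[rotated])
    moreover have "2 * a + 1 - int r = 2 * int m - int r - 1 - 2 * int d" unfolding a_def by simp
    ultimately show ?thesis by (intro criterion_generic[OF Q r]) simp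
  qed
qed (use m in simp)

text \<open>For this \<open>m\<close> the finest partition, \<open>r = m - 1\<close>, becomes tight
  and lowers the admissible number of missing edges from \<open>2 * m - 2 * d - 2 = m\<close> to
  \<open>m - 1\<close>.\<close>

lemma kappa_bar_ge_even:
  assumes d: "m = 2 * d + 2" and h: "card H + 1 \<le> m" and m: "11 \<le> m"
  shows "Suc d \<le> kappa_bar m (V, E)"
proof (rule kappa_bar_ge)
  fix Q :: "('a \<times> 'a) set" assume Q: "equiv UNIV Q"
  have pm: "card (W // Q) \<le> m"
    unfolding quotient_eq_image using card_image_le[OF finW] cardW by metis
  have "card (W // Q) \<noteq> 0"
    using finW cardW m by (auto simp: quotient_eq_image)
  then obtain r where r: "card (W // Q) = Suc r" using not0_implies_Suc by blast
  consider "r = 0" | "r = 1" | "2 \<le> r" by linarith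
  then show "merged Q + d * card (W // Q) \<le> card (crossing Q EW) + Suc d"
  proof cases
    case 1
    then show ?thesis using merged_le(1)[OF Q] r by simp
  next
    case 2
    have "1 \<le> d" "card H + 2 * d + 2 \<le> 2 * m" using d h m by linarith+
    then show ?thesis using criterion_two[OF Q, of d] 2 r d m by simp
  next
    case 3
    \<comment> \<open>Concavity between \<open>r = 2\<close> and
      \<open>r = 2 * d + 1 = m - 1\<close>, where the bounds agree; two classes were treated
      separately.\<close>
    have "0 \<le> (int r - 2) * (2 * int d + 1 - int r)"
      using 3 pm r d by (intro mult_nonneg_nonneg) auto
    then have "2 * (2 * int d + 1) \<le> int r * (2 * int d + 3 - int r)" by (simp add: algebra_simps)
    moreover have "2 * int (card H) \<le> 2 * (2 * int d + 1)" using h d by simp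
    ultimately have "2 * int (card H) \<le> int r * (2 * int d + 3 - int r)" by (rule order_trans[rotated])
    moreover have "2 * int d + 3 - int r = 2 * int m - int r - 1 - 2 * int d" using d by simp
    ultimately show ?thesis by (intro criterion_generic[OF Q r]) simp
  qed
qed (use m in simp)

text \<open>With so few missing edges the general count covers two classes as well. For
  \<open>m = 2 * d + 1\<close> it is tight at \<open>r = 1\<close> and \<open>r = m - 1\<close>, for
  \<open>m = 2 * d\<close> at \<open>r = m - 1\<close>.\<close>

lemma kappa_bar_ge_near_complete:
  assumes m: "2 \<le> m" and dm: "m = 2 * d + 1 \<and> card H \<le> d \<or> m = 2 * d \<and> card H = 0"
  shows "Suc d \<le> kappa_bar m (V, E)"
proof (rule kappa_bar_ge[OF m])
  fix Q :: "('a \<times> 'a) set" assume Q: "equiv UNIV Q"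
  have pm: "card (W // Q) \<le> m"
    unfolding quotient_eq_image using card_image_le[OF finW] cardW by metis
  have "card (W // Q) \<noteq> 0"
    using finW cardW m by (auto simp: quotient_eq_image)
  then obtain r where r: "card (W // Q) = Suc r" using not0_implies_Suc by blast
  show "merged Q + d * card (W // Q) \<le> card (crossing Q EW) + Suc d"
  proof (cases "r = 0")
    case True
    then show ?thesis using merged_le(1)[OF Q] r by simp
  next
    case False
    from dm have "2 * int (card H) \<le> int r * (2 * int m - int r - 1 - 2 * int d)"
    proof
      assume *: "m = 2 * d + 1 \<and> card H \<le> d"
      have "0 \<le> (int r - 1) * (2 * int d - int r)"
        using False pm r * by (intro mult_nonneg_nonneg) auto
      then have "2 * int d \<le> int r * (2 * int d + 1 - int r)" by (simp add: algebra_simps)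
      then have "2 * int (card H) \<le> int r * (2 * int d + 1 - int r)" using * by linarith
      moreover have "2 * int d + 1 - int r = 2 * int m - int r - 1 - 2 * int d" using * by simp
      ultimately show ?thesis by simp
    next
      assume *: "m = 2 * d \<and> card H = 0"
      then have "0 \<le> int r * (2 * int d - 1 - int r)"
        using pm r by (intro mult_nonneg_nonneg) auto
      then show ?thesis using * by (simp add: algebra_simps)
    qed
    then show ?thesis by (rule criterion_generic[OF Q r])
  qed
qed

end

lemma dense_graph_exists:
  assumes "simple_graph (V, E)" "card V = Suc m"
  obtains v where "dense_graph V E v m"
proof -
  have fV: "finite V" and EV: "E \<subseteq> pairs V" using assms(1) unfolding simple_graph_iff_pairs by auto
  let ?d = "\<lambda>x. card {e \<in> pairs V - E. x \<in> e}"
  have "Max (?d ` V) \<in> ?d ` V" using fV assms(2) by (intro Max_in) auto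
  then obtain v where v: "v \<in> V" "?d v = Max (?d ` V)" by force
  then have "?d x \<le> ?d v" if "x \<in> V" for x using fV that by simp
  then show ?thesis using that[of v] fV EV v assms(2) by (simp add: dense_graph.intro)
qed

section \<open>Extremal graphs\<close>

lemma Suc_choose_2: "Suc m choose 2 = m + (m choose 2)"
  by (simp add: numeral_2_eq_2)

lemma twice_choose_2: "2 * (m choose 2) = m * (m - 1)"
  by (cases m) (simp_all add: choose_two)

section \<open>Upper bounds on the number of edges\<close>

lemma card_missing_edges:
  assumes "simple_graph (V, E)" "card V = n"
  shows "card E + card (pairs V - E) = n choose 2"
proof -
  have "finite V" "E \<subseteq> pairs V" using assms(1) unfolding simple_graph_iff_pairs by auto
  then show ?thesis
    using card_pairs[of V] finite_pairs[of V] assms(2) card_mono[of "pairs V" E]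
    by (simp add: card_Diff_subset finite_subset)
qed

lemma card_edges_le_sparse:
  assumes G: "simple_graph (V, E)" "card V = Suc m" and l: "1 \<le> l" "2 * l + 3 \<le> m" "11 \<le> m"
    and kappa: "kappa_bar m (V, E) \<le> l"
  shows "card E \<le> ((m - 1) choose 2) + 2 * l"
proof -
  obtain v where "dense_graph V E v m" using dense_graph_exists[OF G] .
  then interpret dense_graph V E v m .
  have "\<not> card H + 2 * l + 2 \<le> 2 * m"
    using kappa_bar_ge_sparse_complement[OF l(1) _ l(2,3)] kappa by linarith
  moreover have "card E + card H = Suc m choose 2"
    using card_missing_edges[OF G] unfolding H_def .
  moreover have "Suc m choose 2 = m + (m - 1) + ((m - 1) choose 2)"
    using Suc_choose_2[of m] Suc_choose_2[of "m - 1"] l by simp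
  ultimately show ?thesis using l by linarith
qed

lemma card_edges_le_even:
  assumes G: "simple_graph (V, E)" "card V = Suc m" and l: "m = 2 * l + 2" "11 \<le> m"
    and kappa: "kappa_bar m (V, E) \<le> l"
  shows "card E \<le> m choose 2"
proof -
  obtain v where "dense_graph V E v m" using dense_graph_exists[OF G] .
  then interpret dense_graph V E v m .
  have "\<not> card H + 1 \<le> m"
    using kappa_bar_ge_even[OF l(1) _ l(2)] kappa by linarith
  moreover have "card E + card H = Suc m choose 2"
    using card_missing_edges[OF G] unfolding H_def .
  ultimately show ?thesis using Suc_choose_2[of m] by linarith
qed

text \<open>\<open>h\<close> is the number of missing edges that still leaves \<open>Suc l\<close>
  trees.\<close>

lemma card_edges_le_near_complete:
  assumes G: "simple_graph (V, E)" "card V = Suc m" and m: "2 \<le> m"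
    and l: "m = 2 * l + 1 \<and> h = l \<or> m = 2 * l \<and> h = 0"
    and kappa: "kappa_bar m (V, E) \<le> l"
  shows "card E + h < Suc m choose 2"
proof -
  obtain v where "dense_graph V E v m" using dense_graph_exists[OF G] .
  then interpret dense_graph V E v m .
  have "\<not> card H \<le> h"
    using kappa_bar_ge_near_complete[OF m, of l] kappa l by (metis Suc_n_not_le_n le_zero_eq order_trans)
  moreover have "card E + card H = Suc m choose 2"
    using card_missing_edges[OF G] unfolding H_def .
  ultimately show ?thesis by linarith
qed

section \<open>Graphs attaining the bounds\<close>

text \<open>\<open>Suc l\<close> trees on the \<open>m\<close> vertices other than \<open>v\<close>
  use \<open>Suc l * (m - 1)\<close> edges, and at least one more if a tree passes through
  \<open>v\<close>. Hence a weak bound for all edges and a strict one for those that avoid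
  \<open>v\<close>.\<close>

lemma kappa_bar_le_count:
  assumes G: "simple_graph (V, E)" "card V = Suc m" and E: "card E \<le> Suc l * (m - 1)"
    and avoid: "\<And>v. v \<in> V \<Longrightarrow> card {e \<in> E. v \<notin> e} < Suc l * (m - 1)"
  shows "kappa_bar m (V, E) \<le> l"
proof -
  have "kappa_bar (card V - 1) (V, E) \<le> l"
  proof (rule kappa_bar_pred_leI[OF G(1)])
    show "V \<noteq> {}" using G(2) by auto
    fix v F assume v: "v \<in> V" and F: "disjoint_tree_family (V, E) (V - {v}) F"
    show "card F \<le> l"
    proof (rule ccontr)
      assume "\<not> card F \<le> l"
      then have "Suc l * (m - 1) \<le> card F * (m - 1)" by (intro mult_le_mono1) simp
      moreover have "card F * (m - 1) \<le> card {e \<in> E. v \<notin> e} \<or> card F * (m - 1) < card E"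
        using disjoint_trees_count[OF G(1) F v] G(2) by simp
      ultimately show False using avoid[OF v] E by linarith
    qed
  qed
  then show ?thesis using G(2) by simp
qed

lemma kappa_bar_le_count_all:
  assumes G: "simple_graph (V, E)" "card V = Suc m" and E: "card E \<le> Suc l * (m - 1)"
    and m: "m choose 2 < Suc l * (m - 1)"
  shows "kappa_bar m (V, E) \<le> l"
proof (rule kappa_bar_le_count[OF G E])
  fix v assume v: "v \<in> V"
  have fV: "finite V" and EV: "E \<subseteq> pairs V" using G(1) unfolding simple_graph_iff_pairs by auto
  have "card {e \<in> E. v \<notin> e} \<le> card (pairs (V - {v}))"
    using EV fV finite_pairs[of "V - {v}"] by (intro card_mono) (auto simp: pairs_def)
  also have "\<dots> = m choose 2" using fV G(2) v by (simp add: card_pairs)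
  finally show "card {e \<in> E. v \<notin> e} < Suc l * (m - 1)" using m by simp
qed

lemma max_edges_eqI:
  assumes ex: "simple_graph (V :: nat set, E)" "card V = Suc m" "kappa_bar m (V, E) \<le> l" "card E = b"
    and up: "\<And>(V :: nat set) E. simple_graph (V, E) \<Longrightarrow> card V = Suc m \<Longrightarrow> kappa_bar m (V, E) \<le> l \<Longrightarrow> card E \<le> b"
  shows "max_edges (Suc m) m l = b"
  unfolding max_edges_def
proof (rule Max_eqI[OF max_edges_set_finite])
  show "b \<in> {card (edges G) |G :: nat graph. simple_graph G \<and> card (verts G) = Suc m \<and> kappa_bar m G \<le> l}"
    using ex by (intro CollectI exI[of _ "(V, E)"]) simp
qed (use up in auto)

lemma simple_graph_with_edges_exists:
  assumes "b \<le> n choose 2"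
  obtains E where "simple_graph ({..<n}, E)" "card E = b"
proof -
  have "b \<le> card (pairs {..<n})" using assms by (simp add: card_pairs)
  then obtain E where "E \<subseteq> pairs {..<n}" "card E = b" by (rule obtain_subset_with_card_n)
  then show ?thesis using that unfolding simple_graph_iff_pairs by auto
qed

text \<open>Under these inequalities any graph with \<open>b\<close> edges is extremal, whatever its
  shape.\<close>

lemma max_edges_eq_count:
  assumes b: "b \<le> Suc m choose 2" "b \<le> Suc l * (m - 1)" and m: "m choose 2 < Suc l * (m - 1)"
    and up: "\<And>(V :: nat set) E. simple_graph (V, E) \<Longrightarrow> card V = Suc m \<Longrightarrow> kappa_bar m (V, E) \<le> l \<Longrightarrow> card E \<le> b"
  shows "max_edges (Suc m) m l = b"
proof -
  obtain E where E: "simple_graph ({..<Suc m}, E)" "card E = b"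
    by (rule simple_graph_with_edges_exists[OF b(1)])
  have "kappa_bar m ({..<Suc m}, E) \<le> l"
    using E b(2) m by (intro kappa_bar_le_count_all) simp_all
  then show ?thesis using E up by (intro max_edges_eqI) simp_all
qed

lemma extremal_graph_sparse:
  assumes m: "2 \<le> m" and l: "l \<le> m - 1"
  obtains E where "simple_graph ({..m}, E)" "kappa_bar m ({..m}, E) \<le> l"
    "card E = ((m - 1) choose 2) + 2 * l"
proof -
  define star where "star x = (\<lambda>i. {i, x}) ` {..<l}" for x :: nat
  define E where "E = pairs {..<m - 1} \<union> star (m - 1) \<union> star m"
  have G: "simple_graph ({..m}, E)"
    using m l unfolding simple_graph_iff_pairs E_def star_def pairs_def by auto
  have star: "card (star x) = l" if "m - 1 \<le> x" for x
    unfolding star_def using that l by (subst card_image) (auto simp: inj_on_def doubleton_eq_iff)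
  have "card E = card (pairs {..<m - 1}) + card (star (m - 1)) + card (star m)"
  proof -
    have "pairs {..<m - 1} \<inter> star (m - 1) = {}" "(pairs {..<m - 1} \<union> star (m - 1)) \<inter> star m = {}"
      using l m unfolding star_def pairs_def by (auto simp: doubleton_eq_iff)
    moreover have "finite (pairs {..<m - 1})" "finite (star x)" for x
      unfolding star_def by (auto intro: finite_pairs)
    ultimately show ?thesis unfolding E_def by (simp add: card_Un_disjoint)
  qed
  then have card: "card E = ((m - 1) choose 2) + 2 * l" using star by (simp add: card_pairs)
  have deg: "card {e \<in> E. x \<in> e} \<le> l" if "x = m - 1 \<or> x = m" for x
  proof -
    have "{e \<in> E. x \<in> e} \<subseteq> star x"
      using that l m unfolding E_def star_def pairs_def by auto
    moreover have "finite (star x)" unfolding star_def by simp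
    ultimately show ?thesis using star[of x] card_mono[of "star x"] that by fastforce
  qed
  have "kappa_bar (card {..m} - 1) ({..m}, E) \<le> l"
  proof (rule kappa_bar_pred_leI[OF G])
    fix v F assume v: "v \<in> {..m}" and F: "disjoint_tree_family ({..m}, E) ({..m} - {v}) F"
    \<comment> \<open>One of the two vertices of degree at most \<open>l\<close> that is left when
      \<open>v\<close> is removed.\<close>
    define x where "x = (if v = m then m - 1 else m)"
    have "x \<in> {..m} - {v}" using m unfolding x_def by auto
    then have "card F \<le> card {e \<in> E. x \<in> e}"
      using v m by (intro card_disjoint_trees_le_degree[OF G F]) auto
    also have "\<dots> \<le> l" by (rule deg) (simp add: x_def)
    finally show "card F \<le> l" .
  qed simp
  then show ?thesis using that G card by simp
qed

text \<open>
  Here \<open>m choose 2 = (l + 1) * (m - 1)\<close>, so counting edges only excludes \<open>l + 1\<close> trees if no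
  vertex is isolated; this is what the exchange of one edge achieves.
\<close>

lemma extremal_graph_even:
  assumes m: "m = 2 * l + 2" "11 \<le> m"
  obtains E where "simple_graph ({..m}, E)" "kappa_bar m ({..m}, E) \<le> l" "card E = m choose 2"
proof -
  define E where "E = insert {0, m} (pairs {..<m} - {{0, 1}})"
  have G: "simple_graph ({..m}, E)"
    using m unfolding simple_graph_iff_pairs E_def pairs_def by auto
  have "{0, 1} \<in> pairs {..<m}" using m by (intro pairsI) auto
  moreover have "{0, m} \<notin> pairs {..<m}" unfolding pairs_def by simp
  moreover have "0 < card (pairs {..<m})"
    using calculation(1) finite_pairs[of "{..<m}"] by (metis card_gt_0_iff empty_iff finite_lessThan)
  ultimately have card: "card E = m choose 2"
    unfolding E_def using finite_pairs[of "{..<m}"] by (simp add: card_pairs)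
  have eq: "m choose 2 = Suc l * (m - 1)"
  proof -
    have "2 * (m choose 2) = 2 * (Suc l * (m - 1))" unfolding twice_choose_2 using m(1) by simp
    then show ?thesis by simp
  qed
  have "kappa_bar m ({..m}, E) \<le> l"
  proof (rule kappa_bar_le_count[OF G])
    fix v assume v: "v \<in> {..m}"
    have "\<exists>e\<in>E. v \<in> e"
    proof -
      consider "v = 0 \<or> v = m" | "v = 1" | "2 \<le> v" "v < m" using v by fastforce
      then show ?thesis
      proof cases
        case 1
        then show ?thesis unfolding E_def by auto
      next
        case 2
        have "{1, 2} \<in> E"
          using m unfolding E_def by (auto intro!: pairsI simp: doubleton_eq_iff)
        then show ?thesis using 2 by auto
      next
        case 3
        then have "{0, v} \<in> E"
          unfolding E_def by (auto intro!: pairsI simp: doubleton_eq_iff)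
        then show ?thesis by auto
      qed
    qed
    then have "{e \<in> E. v \<notin> e} \<subset> E" by auto
    then have "card {e \<in> E. v \<notin> e} < card E"
      using simple_graph_finite_edges[OF G] by (rule psubset_card_mono[rotated])
    then show "card {e \<in> E. v \<notin> e} < Suc l * (m - 1)" using card eq by simp
  qed (use card eq in simp_all)
  then show ?thesis using that G card by simp
qed

theorem corollary3:
  fixes n l :: nat
  assumes "12 \<le> n" and "1 \<le> l" and "l \<le> (n + 1) div 2"
  shows
    "((1 \<le> l \<and> l \<le> (n - 5) div 2 \<or> l = (n - 3) div 2 \<and> even n) \<longrightarrow>
        max_edges n (n - 1) l = ((n - 2) choose 2) + 2 * l) \<and>
     (l = (n - 3) div 2 \<and> odd n \<longrightarrow>
        max_edges n (n - 1) l = ((n - 2) choose 2) + 2 * l + 1) \<and>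
     (l = (n - 1) div 2 \<and> even n \<longrightarrow>
        max_edges n (n - 1) l = ((n - 1) choose 2) + l) \<and>
     (l = (n - 1) div 2 \<and> odd n \<longrightarrow>
        max_edges n (n - 1) l = ((n - 1) choose 2) + 2 * l - 1) \<and>
     (l = (n + 1) div 2 \<longrightarrow>
        max_edges n (n - 1) l = (n choose 2))"
proof (intro conjI impI)
  \<comment> \<open>In terms of \<open>m\<close> the cases read \<open>2 * l + 3 <= m\<close>,
    \<open>m = 2 * l + 2\<close>, \<open>m = 2 * l + 1\<close>, \<open>m = 2 * l\<close> and
    \<open>m + 1 <= 2 * l\<close>.\<close>
  obtain m where n: "n = Suc m" and m: "11 \<le> m"
    using assms(1) by (cases n) auto
  {
    assume "1 \<le> l \<and> l \<le> (n - 5) div 2 \<or> l = (n - 3) div 2 \<and> even n"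
    then have l: "2 * l + 3 \<le> m" using m unfolding n by (auto elim!: evenE oddE)
    obtain E where "simple_graph ({..m}, E)" "kappa_bar m ({..m}, E) \<le> l"
        "card E = ((m - 1) choose 2) + 2 * l"
      by (rule extremal_graph_sparse[of m l]) (use l in auto)
    then have "max_edges (Suc m) m l = ((m - 1) choose 2) + 2 * l"
      using card_edges_le_sparse[OF _ _ assms(2) l m] by (intro max_edges_eqI) auto
    then show "max_edges n (n - 1) l = ((n - 2) choose 2) + 2 * l" by (simp add: n)
  next
    assume "l = (n - 3) div 2 \<and> odd n"
    then have l: "m = 2 * l + 2" using m unfolding n by (auto elim!: evenE)
    obtain E where "simple_graph ({..m}, E)" "kappa_bar m ({..m}, E) \<le> l" "card E = m choose 2"
      by (rule extremal_graph_even[OF l m])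
    then have "max_edges (Suc m) m l = m choose 2"
      using card_edges_le_even[OF _ _ l m] by (intro max_edges_eqI) auto
    moreover have "m choose 2 = ((m - 1) choose 2) + 2 * l + 1"
      using Suc_choose_2[of "m - 1"] l by simp
    ultimately show "max_edges n (n - 1) l = ((n - 2) choose 2) + 2 * l + 1" by (simp add: n)
  next
    assume "l = (n - 1) div 2 \<and> even n"
    then have l: "m = 2 * l + 1" unfolding n by (auto elim!: oddE)
    have c: "2 * (m choose 2) = (2 * l + 1) * (2 * l)" unfolding twice_choose_2 using l by simp
    have "max_edges (Suc m) m l = (m choose 2) + l"
    proof (rule max_edges_eq_count)
      show "(m choose 2) + l \<le> Suc m choose 2" using Suc_choose_2[of m] l by simp
      \<comment> \<open>The claimed maximum is exactly \<open>Suc l * (m - 1)\<close>, here and in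
        the next case.\<close>
      have "2 * ((m choose 2) + l) = 2 * (Suc l * (m - 1))" using c l by (simp add: algebra_simps)
      then show "(m choose 2) + l \<le> Suc l * (m - 1)" by simp
      then show "m choose 2 < Suc l * (m - 1)" using assms(2) by linarith
      show "card E \<le> (m choose 2) + l"
        if "simple_graph (V, E)" "card V = Suc m" "kappa_bar m (V, E) \<le> l" for V :: "nat set" and E
        using card_edges_le_near_complete[OF that(1,2) _ _ that(3), of l] m l Suc_choose_2[of m] by simp
    qed
    then show "max_edges n (n - 1) l = ((n - 1) choose 2) + l" by (simp add: n)
  next
    assume "l = (n - 1) div 2 \<and> odd n"
    then have l: "m = 2 * l" unfolding n by (auto elim!: evenE)
    have c: "2 * (m choose 2) = (2 * l) * (m - 1)" unfolding twice_choose_2 using l by simp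
    then have c': "m choose 2 = l * (m - 1)" by simp
    have "max_edges (Suc m) m l = (m choose 2) + 2 * l - 1"
    proof (rule max_edges_eq_count)
      show "(m choose 2) + 2 * l - 1 \<le> Suc m choose 2" using Suc_choose_2[of m] l by simp
      show "(m choose 2) + 2 * l - 1 \<le> Suc l * (m - 1)" using c' l m by simp
      show "m choose 2 < Suc l * (m - 1)" using c' m by simp
      show "card E \<le> (m choose 2) + 2 * l - 1"
        if "simple_graph (V, E)" "card V = Suc m" "kappa_bar m (V, E) \<le> l" for V :: "nat set" and E
        using card_edges_le_near_complete[OF that(1,2) _ _ that(3), of 0] m l Suc_choose_2[of m] by simp
    qed
    then show "max_edges n (n - 1) l = ((n - 1) choose 2) + 2 * l - 1" by (simp add: n)
  next
    assume "l = (n + 1) div 2"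
    then have l: "m + 1 \<le> 2 * l" unfolding n by simp
    \<comment> \<open>Even the complete graph has too few edges for \<open>Suc l\<close> trees:
      \<open>2 * Suc l >= m + 3\<close>, and \<open>(m + 1) * m <= (m + 3) * (m - 1)\<close> from
      \<open>m = 3\<close> on, which is why \<open>t\<close> is split off.\<close>
    obtain t where t: "m = t + 3" using m by (metis add.commute le_Suc_ex order_trans numeral_le_iff semiring_norm)
    have "(m + 3) * (m - 1) \<le> 2 * (Suc l * (m - 1))"
      using l by (simp only: mult.assoc[symmetric]) (intro mult_le_mono1, simp)
    moreover have "2 * (Suc m choose 2) \<le> (m + 3) * (m - 1)"
      unfolding twice_choose_2 t by (simp add: algebra_simps)
    ultimately have b: "Suc m choose 2 \<le> Suc l * (m - 1)" by linarith
    have "max_edges (Suc m) m l = Suc m choose 2"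
    proof (rule max_edges_eq_count[OF order_refl b])
      show "m choose 2 < Suc l * (m - 1)" using b Suc_choose_2[of m] m by linarith
      show "card E \<le> Suc m choose 2"
        if "simple_graph (V, E)" "card V = Suc m" "kappa_bar m (V, E) \<le> l" for V :: "nat set" and E
        using card_missing_edges[OF that(1,2)] by linarith
    qed
    then show "max_edges n (n - 1) l = (n choose 2)" by (simp add: n)
  }
qed

end
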